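(* Let $F:\Theta^*\to 2^Z\setminus\{\emptyset\}$. Then $F$ is mixed-Nash-A-implementable on the state space $\Theta_{\mathbb Q}=\{(\theta,u):\theta\in\Theta^*,u\in\Omega^{[\succeq^\theta,\mathbb Q]}\}$ if and only if it is mixed-Nash-A-implementable on $\Theta_{\mathbb R}=\{(\theta,u):\theta\in\Theta^*,u\in\Omega^{[\succeq^\theta,\mathbb R]}\}$, where in both cases the SCC assigns $F(\theta)$ to the state $(\theta,u)$. Explicitly: there is a mechanism $\mathcal M$ with $\bigcup_{\lambda\in MNE^{(\mathcal M,u)}}\mathrm{SUPP}(g[\lambda])=F(\theta)$ for all $\theta\in\Theta^*$, $u\in\Omega^{[\succeq^\theta,\mathbb Q]}$ iff there is a mechanism with this property for all $\theta\in\Theta^*$, $u\in\Omega^{[\succeq^\theta,\mathbb R]}$.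
   Context: Ordinal model: $\mathcal I=\{1,\dots,I\}$ finite with $I\ge3$; $Z$ finite; $Y=\Delta(Z)$; $\Theta^*$ is a finite set of ordinal states, each $\theta$ specifying complete preorders $(\succeq_i^\theta)_{i\in\mathcal I}$ on $Z$. For $\mathbb K\in\{\mathbb R,\mathbb Q\}$, $\Omega^{[\succeq^\theta,\mathbb K]}$ is the set of profiles $u=(u_i:Z\to\mathbb K)_i$ with $z\succeq_i^\theta z'\iff u_i(z)\ge u_i(z')$ for all $i,z,z'$. Under cardinal state $u$, agent $i$ evaluates $y\in Y$ by $\sum_zy_zu_i(z)$. A mechanism $\mathcal M=\langle M=\times_iM_i,g:M\to Y\rangle$ has countable $M_i$; $g(\lambda)$ is the lottery induced by a mixed profile $\lambda$; $MNE^{(\mathcal M,u)}$ is the set of mixed-strategy Nash equilibria under $u$. *)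

theory Defs
  imports "HOL-Probability.Product_PMF"
begin

(* Agents: a finite type 'i.  Outcomes: a finite type 'z.  Lotteries Y = Delta(Z): 'z pmf.
   Message spaces: each M i is a nonempty subset of nat (i.e. an arbitrary countable set,
   up to relabelling).  Outcome function g : profiles -> lotteries. *)

definition complete_preorder :: "('z \<Rightarrow> 'z \<Rightarrow> bool) \<Rightarrow> bool" where
  "complete_preorder r \<longleftrightarrow> (\<forall>x y. r x y \<or> r y x) \<and> (\<forall>x y z. r x y \<longrightarrow> r y z \<longrightarrow> r x z)"

definition mechanism :: "('i \<Rightarrow> nat set) \<Rightarrow> bool" where
  "mechanism M \<longleftrightarrow> (\<forall>i. M i \<noteq> {})"

definition mixed_profile :: "('i \<Rightarrow> nat set) \<Rightarrow> ('i \<Rightarrow> nat pmf) \<Rightarrow> bool" where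
  "mixed_profile M lam \<longleftrightarrow> (\<forall>i. set_pmf (lam i) \<subseteq> M i)"

definition outcome :: "(('i::finite \<Rightarrow> nat) \<Rightarrow> 'z pmf) \<Rightarrow> ('i \<Rightarrow> nat pmf) \<Rightarrow> 'z pmf" where
  "outcome g lam = bind_pmf (Pi_pmf UNIV undefined lam) g"

definition eu :: "('i \<Rightarrow> 'z::finite \<Rightarrow> real) \<Rightarrow> 'i \<Rightarrow> 'z pmf \<Rightarrow> real" where
  "eu u i y = (\<Sum>z\<in>UNIV. pmf y z * u i z)"

definition MNE :: "('i::finite \<Rightarrow> nat set) \<Rightarrow> (('i \<Rightarrow> nat) \<Rightarrow> 'z::finite pmf)
    \<Rightarrow> ('i \<Rightarrow> 'z \<Rightarrow> real) \<Rightarrow> ('i \<Rightarrow> nat pmf) set" where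
  "MNE M g u = {lam. mixed_profile M lam \<and>
     (\<forall>i mu. set_pmf mu \<subseteq> M i \<longrightarrow> eu u i (outcome g (lam(i := mu))) \<le> eu u i (outcome g lam))}"

definition Omega :: "('i \<Rightarrow> 'z \<Rightarrow> 'z \<Rightarrow> bool) \<Rightarrow> real set \<Rightarrow> ('i \<Rightarrow> 'z \<Rightarrow> real) set" where
  "Omega R K = {u. (\<forall>i z z'. R i z z' \<longleftrightarrow> u i z \<ge> u i z') \<and> (\<forall>i z. u i z \<in> K)}"

definition mixed_Nash_A_implementable ::
  "'th set \<Rightarrow> ('th \<Rightarrow> 'i::finite \<Rightarrow> 'z::finite \<Rightarrow> 'z \<Rightarrow> bool) \<Rightarrow> ('th \<Rightarrow> 'z set) \<Rightarrow> real set \<Rightarrow> bool" where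
  "mixed_Nash_A_implementable Th R F K \<longleftrightarrow>
     (\<exists>M g. mechanism M \<and>
        (\<forall>\<theta>\<in>Th. \<forall>u\<in>Omega (R \<theta>) K. (\<Union>lam\<in>MNE M g u. set_pmf (outcome g lam)) = F \<theta>))"

end

theory Submission
  imports Defs
begin

text \<open>Only the passage from rational to real utilities needs an argument. Fix a mechanism that works
  for rational utilities and one rational utility profile \<open>v \<theta>\<close> per ordinal state. Let \<open>Zs\<close> be the set
  of outcomes that the mechanism can reach and \<open>E j \<theta>\<close> the set of outcomes that agent \<open>j\<close> can reach by
  deviating from equilibria at \<open>v \<theta>\<close>. Implementation at rational utilities forces purely ordinal
  conditions on \<open>F\<close>, \<open>Zs\<close> and \<open>E\<close>, because whenever the ordinal ranking changes monotonically from
  \<open>\<theta>\<close> to \<open>\<theta>'\<close>, some rational utility for \<open>\<theta>'\<close> agrees with \<open>v \<theta>\<close> on \<open>F \<theta>\<close> and lies below it on \<open>E\<close>,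
  so that every equilibrium at \<open>v \<theta>\<close> survives.

  Conversely these conditions suffice for a Maskin-type mechanism that works for all real utilities.
  Consensus on \<open>\<theta>\<close> yields the uniform lottery on \<open>F \<theta>\<close>. Messages cannot report a real utility, so the
  lotteries offered to a single deviator depend on an integer announced by the others, which bounds
  the ratios of utility differences: in the true state a large enough integer makes all offers
  unattractive, whatever the real utility is, while in any other state each offer keeps its ordinal
  advantage. The deviator and the winner of the integer game receive the chosen lottery mixed with
  noise that vanishes as the announced level grows, so in equilibrium they must be indifferent.\<close>

section \<open>Expected utility of compound lotteries\<close>

lemma integrable_pmf_bounded:
  fixes f :: "'a \<Rightarrow> real"
  assumes "\<And>x. \<bar>f x\<bar> \<le> B"
  shows "integrable (measure_pmf p) f"
  by (rule measure_pmf.integrable_const_bound[where B = B]) (auto simp: assms)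

lemma integrable_pmf_finite_range:
  fixes f :: "'a \<Rightarrow> real"
  assumes "finite S" "\<And>x. f x \<in> S"
  shows "integrable (measure_pmf p) f"
proof (rule integrable_pmf_bounded)
  fix x show "\<bar>f x\<bar> \<le> Max (abs ` S)" using assms by auto
qed

text \<open>A nonnegative function with zero integral vanishes almost everywhere, which for a
  \<open>pmf\<close> means on the whole support. This turns equalities between expectations into
  equalities at each point that can occur.\<close>

lemma expectation_attains_bound:
  fixes f :: "'a \<Rightarrow> real"
  assumes int: "integrable (measure_pmf p) f" and le: "\<And>x. x \<in> set_pmf p \<Longrightarrow> f x \<le> c"
    and eq: "measure_pmf.expectation p f = c" and x: "x \<in> set_pmf p"
  shows "f x = c"
proof -
  have "measure_pmf.expectation p (\<lambda>x. c - f x) = 0"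
    using int eq by simp
  moreover have "AE x in measure_pmf p. 0 \<le> c - f x"
    using le by (simp add: AE_measure_pmf_iff)
  ultimately have "AE x in measure_pmf p. c - f x = 0"
    using int by (subst (asm) integral_nonneg_eq_0_iff_AE) auto
  then show ?thesis using x by (simp add: AE_measure_pmf_iff)
qed

lemma expectation_pos:
  fixes f :: "'a \<Rightarrow> real"
  assumes int: "integrable (measure_pmf p) f" and nn: "\<And>x. 0 \<le> f x"
    and x: "x \<in> set_pmf p" "f x > 0"
  shows "measure_pmf.expectation p f > 0"
proof -
  have "measure_pmf.expectation p f \<noteq> 0"
  proof
    assume "measure_pmf.expectation p f = 0"
    then have "AE x in measure_pmf p. f x = 0"
      using int nn by (subst (asm) integral_nonneg_eq_0_iff_AE) auto
    then show False using x by (auto simp: AE_measure_pmf_iff)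
  qed
  moreover have "measure_pmf.expectation p f \<ge> 0" using nn by simp
  ultimately show ?thesis by simp
qed

lemma eu_eq_expectation: "eu u i y = measure_pmf.expectation y (u i)"
  unfolding eu_def by (subst integral_measure_pmf[where A = UNIV]) (auto simp: mult.commute)

lemma eu_bounded: "\<bar>eu u i y\<bar> \<le> (\<Sum>z\<in>UNIV. \<bar>u i z\<bar>)"
  unfolding eu_def
proof (rule order_trans[OF sum_abs], rule sum_mono)
  fix z show "\<bar>pmf y z * u i z\<bar> \<le> \<bar>u i z\<bar>"
    by (simp add: abs_mult pmf_le_1 mult_left_le_one_le)
qed

lemma integrable_eu: "integrable (measure_pmf p) (\<lambda>x. eu u i (f x))"
  by (rule integrable_pmf_bounded[OF eu_bounded])

lemma eu_bind: "eu u i (bind_pmf p f) = measure_pmf.expectation p (\<lambda>x. eu u i (f x))"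
proof -
  have "integrable (measure_pmf p) (\<lambda>x. pmf (f x) z)" for z
    by (rule integrable_pmf_bounded[of _ 1]) (simp add: pmf_le_1)
  then show ?thesis
    unfolding eu_def by (subst Bochner_Integration.integral_sum) (auto simp: pmf_bind)
qed

lemma eu_return [simp]: "eu u i (return_pmf z) = u i z"
  by (simp add: eu_eq_expectation)

lemma eu_le:
  assumes "\<And>z. z \<in> set_pmf y \<Longrightarrow> u i z \<le> c"
  shows "eu u i y \<le> c"
proof -
  have "measure_pmf.expectation y (u i) \<le> measure_pmf.expectation y (\<lambda>_. c)"
    by (rule integral_mono_AE)
      (auto simp: AE_measure_pmf_iff assms intro: integrable_pmf_finite_range[of "range (u i)"])
  then show ?thesis by (simp add: eu_eq_expectation)
qed

lemma eu_const:
  assumes "\<And>z. z \<in> set_pmf y \<Longrightarrow> u i z = c"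
  shows "eu u i y = c"
proof -
  have "measure_pmf.expectation y (u i) = measure_pmf.expectation y (\<lambda>_. c)"
    by (rule integral_cong_AE) (auto simp: AE_measure_pmf_iff assms)
  then show ?thesis by (simp add: eu_eq_expectation)
qed

lemma eu_le_eu:
  assumes "\<And>z. z \<in> set_pmf y \<Longrightarrow> u i z \<le> v i z"
  shows "eu u i y \<le> eu v i y"
  unfolding eu_eq_expectation
  by (rule integral_mono_AE)
      (auto simp: AE_measure_pmf_iff assms intro: integrable_pmf_finite_range[of "range (u i)"]
       integrable_pmf_finite_range[of "range (v i)"])

lemma eu_attains_bound:
  assumes "\<And>z. z \<in> set_pmf y \<Longrightarrow> u i z \<le> c" "eu u i y = c" "z \<in> set_pmf y"
  shows "u i z = c"
  using expectation_attains_bound[of y "u i" c z] assms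
    integrable_pmf_finite_range[of "range (u i)" "u i" y]
  by (auto simp: eu_eq_expectation)

lemma eu_attains_lower_bound:
  assumes "\<And>z. z \<in> set_pmf y \<Longrightarrow> c \<le> u i z" "eu u i y \<le> c" "z \<in> set_pmf y"
  shows "u i z = c"
proof -
  have *: "eu (\<lambda>i z. - u i z) i y = - eu u i y" by (simp add: eu_def sum_negf)
  have "eu (\<lambda>i z. - u i z) i y \<le> - c" by (rule eu_le) (use assms in auto)
  then have "eu (\<lambda>i z. - u i z) i y = - c" using * assms(2) by simp
  then have "- u i z = - c"
    using eu_attains_bound[of y "\<lambda>i z. - u i z" i "- c" z] assms by simp
  then show ?thesis by simp
qed

section \<open>Mixtures of two lotteries and shifts of mass between outcomes\<close>

definition pmix :: "real \<Rightarrow> 'a pmf \<Rightarrow> 'a pmf \<Rightarrow> 'a pmf" where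
  "pmix c A B = bind_pmf (bernoulli_pmf c) (\<lambda>b. if b then A else B)"

lemma eu_pmix:
  assumes "0 \<le> c" "c \<le> 1"
  shows "eu u i (pmix c A B) = c * eu u i A + (1 - c) * eu u i B"
  unfolding pmix_def eu_bind using assms by (subst integral_bernoulli_pmf) auto

lemma set_pmix_subset: "set_pmf (pmix c A B) \<subseteq> set_pmf A \<union> set_pmf B"
  by (auto simp: pmix_def split: if_splits)

lemma set_pmix_left:
  assumes "0 < c" "c \<le> 1" shows "set_pmf A \<subseteq> set_pmf (pmix c A B)"
proof -
  have "True \<in> set_pmf (bernoulli_pmf c)" using assms by (simp add: set_pmf_iff)
  then show ?thesis unfolding pmix_def by force
qed

lemma set_pmix_right:
  assumes "0 \<le> c" "c < 1" shows "set_pmf B \<subseteq> set_pmf (pmix c A B)"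
proof -
  have "False \<in> set_pmf (bernoulli_pmf c)" using assms by (simp add: set_pmf_iff)
  then show ?thesis unfolding pmix_def by force
qed

definition redirect :: "'a \<Rightarrow> 'a \<Rightarrow> 'a pmf \<Rightarrow> 'a pmf" where
  "redirect x y p = map_pmf (\<lambda>a. if a = x then y else a) p"

lemma eu_redirect: "eu u i (redirect x y p) = eu u i p + pmf p x * (u i y - u i x)"
proof -
  have "eu u i (redirect x y p) = measure_pmf.expectation p (\<lambda>a. u i (if a = x then y else a))"
    by (simp add: eu_eq_expectation redirect_def)
  also have "\<dots> = (\<Sum>a\<in>UNIV. pmf p a * u i (if a = x then y else a))"
    by (subst integral_measure_pmf[where A = UNIV]) (auto simp: mult.commute)
  also have "\<dots> = (\<Sum>a\<in>UNIV. pmf p a * u i a + (if a = x then pmf p x * (u i y - u i x) else 0))"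
    by (rule sum.cong) (auto simp: algebra_simps)
  finally show ?thesis by (simp add: sum.distrib eu_def)
qed

lemma set_redirect: "set_pmf (redirect x y p) \<subseteq> insert y (set_pmf p)"
  by (auto simp: redirect_def)

lemma redirect_target: "x \<in> set_pmf p \<Longrightarrow> y \<in> set_pmf (redirect x y p)"
  by (force simp: redirect_def)

section \<open>Unilateral deviations\<close>

text \<open>The draw of component \<open>i\<close> is overwritten, so its old distribution drops out
  and both sides reduce to the product over the other components. Keeping the full
  \<open>lam\<close> on the right lets the deviations of all agents be integrated against one
  distribution.\<close>

lemma Pi_pmf_fun_upd:
  fixes lam :: "'i::finite \<Rightarrow> 'a pmf"
  shows "Pi_pmf UNIV d (lam(i := mu)) =
    bind_pmf mu (\<lambda>a. map_pmf (\<lambda>m. m(i := a)) (Pi_pmf UNIV d lam))"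
proof -
  have U: "UNIV = insert i (UNIV - {i})" by auto
  have eq: "Pi_pmf (UNIV - {i}) d (lam(i := mu)) = Pi_pmf (UNIV - {i}) d lam"
    by (rule Pi_pmf_cong) auto
  have L: "Pi_pmf UNIV d (lam(i := mu)) =
    bind_pmf mu (\<lambda>a. map_pmf (\<lambda>m. m(i := a)) (Pi_pmf (UNIV - {i}) d lam))"
    by (subst U, subst Pi_pmf_insert') (auto simp: eq map_pmf_def)
  have R: "map_pmf (\<lambda>m. m(i := a)) (Pi_pmf UNIV d lam) =
     map_pmf (\<lambda>m. m(i := a)) (Pi_pmf (UNIV - {i}) d lam)" for a
    by (subst U, subst Pi_pmf_insert')
      (auto simp: map_bind_pmf map_pmf_def[symmetric] pmf.map_comp o_def)
  show ?thesis unfolding L R ..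
qed

lemma eu_outcome_fun_upd:
  "eu u i (outcome g (lam(i := mu))) =
    measure_pmf.expectation mu (\<lambda>a. eu u i (outcome g (lam(i := return_pmf a))))"
  unfolding outcome_def Pi_pmf_fun_upd
  by (simp add: eu_bind bind_assoc_pmf bind_return_pmf)

lemma eu_outcome_return:
  "eu u i (outcome g (lam(i := return_pmf a))) =
    measure_pmf.expectation (Pi_pmf UNIV undefined lam) (\<lambda>m. eu u i (g (m(i := a))))"
  unfolding outcome_def Pi_pmf_fun_upd
  by (simp add: bind_return_pmf bind_map_pmf eu_bind)

lemma MNE_pure_deviation:
  assumes "lam \<in> MNE M g u" "a \<in> M i"
  shows "eu u i (outcome g (lam(i := return_pmf a))) \<le> eu u i (outcome g lam)"
  using assms by (auto simp: MNE_def)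

text \<open>The equilibrium payoff is the average of the payoffs of the pure messages in the
  support, and none of these exceeds it.\<close>

lemma MNE_support:
  assumes lam: "lam \<in> MNE M g u" and a: "a \<in> set_pmf (lam i)"
  shows "eu u i (outcome g (lam(i := return_pmf a))) = eu u i (outcome g lam)"
proof (rule expectation_attains_bound[where p = "lam i" and c = "eu u i (outcome g lam)"])
  show "eu u i (outcome g (lam(i := return_pmf x))) \<le> eu u i (outcome g lam)"
    if "x \<in> set_pmf (lam i)" for x
    using MNE_pure_deviation[OF lam, of x i] that lam unfolding MNE_def mixed_profile_def by blast
  show "measure_pmf.expectation (lam i) (\<lambda>x. eu u i (outcome g (lam(i := return_pmf x)))) =
      eu u i (outcome g lam)"
    using eu_outcome_fun_upd[of u i g lam "lam i"] by simp
qed (use a integrable_eu in auto)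

section \<open>Rational utility representations\<close>

lemma rational_gap:
  fixes S :: "real set"
  assumes "finite S"
  obtains d where "d \<in> \<rat>" "0 < d" "\<And>x y. x \<in> S \<Longrightarrow> y \<in> S \<Longrightarrow> x < y \<Longrightarrow> x + d < y"
proof -
  \<comment> \<open>The element 1 keeps \<open>D\<close> nonempty when \<open>S\<close> has fewer
    than two points.\<close>
  define D where "D = insert 1 {y - x | x y. x \<in> S \<and> y \<in> S \<and> x < y}"
  have "D \<subseteq> insert 1 ((\<lambda>(x,y). y - x) ` (S \<times> S))" by (auto simp: D_def)
  then have fin: "finite D" using assms finite_subset by blast
  have "0 < Min D" using fin by (subst Min_gr_iff) (auto simp: D_def)
  then obtain d where d: "d \<in> \<rat>" "0 < d" "d < Min D" using Rats_dense_in_real by blast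
  have "x + d < y" if "x \<in> S" "y \<in> S" "x < y" for x y
  proof -
    have "Min D \<le> y - x" using fin that by (intro Min_le) (auto simp: D_def)
    then show ?thesis using d by simp
  qed
  then show ?thesis using that d by blast
qed

text \<open>Each point gets the value of the best element of \<open>F\<close> that it weakly beats, plus an
  increment, too small to reach the next value of \<open>v\<close>, which counts the points it beats beyond
  that element.\<close>

lemma rational_representation_below:
  fixes v :: "'z::finite \<Rightarrow> real" and r r' :: "'z \<Rightarrow> 'z \<Rightarrow> bool"
  assumes r': "complete_preorder r'"
    and v: "\<And>x y. r x y \<longleftrightarrow> v x \<ge> v y" "\<And>x. v x \<in> \<rat>"
    and FE: "F \<subseteq> E"
    and weak: "\<And>z w. z \<in> F \<Longrightarrow> w \<in> E \<Longrightarrow> r z w \<Longrightarrow> r' z w"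
    and strict: "\<And>z w. z \<in> F \<Longrightarrow> w \<in> E \<Longrightarrow> r z w \<Longrightarrow> \<not> r w z \<Longrightarrow> \<not> r' w z"
  obtains u where "\<And>x y. r' x y \<longleftrightarrow> u x \<ge> u y" "\<And>x. u x \<in> \<rat>"
    "\<And>z. z \<in> F \<Longrightarrow> u z = v z" "\<And>w. w \<in> E \<Longrightarrow> u w \<le> v w"
proof -
  have tot: "r' x y \<or> r' y x" and tr: "r' x y \<Longrightarrow> r' y z \<Longrightarrow> r' x z" for x y z
    using r' by (auto simp: complete_preorder_def)
  have rfl: "r' x x" for x using tot by blast
  \<comment> \<open>A rational value below all of \<open>v\<close>, the base for points that weakly
    beat no element of \<open>F\<close>.\<close>
  define c where "c = Min (range v) - 1"
  have cv: "c < v x" for x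
  proof -
    have "Min (range v) \<le> v x" by (rule Min_le) auto
    then show ?thesis unfolding c_def by linarith
  qed
  have "Min (range v) \<in> range v" by (rule Min_in) auto
  then have "Min (range v) \<in> \<rat>" using v(2) by force
  then have cQ: "c \<in> \<rat>" by (simp add: c_def)
  obtain d where d: "d \<in> \<rat>" "0 < d"
    and gap: "\<And>x y. x \<in> insert c (range v) \<Longrightarrow> y \<in> insert c (range v) \<Longrightarrow> x < y \<Longrightarrow> x + d < y"
    using rational_gap[of "insert c (range v)"] by auto
  define A where "A w = {z\<in>F. r' w z}" for w
  define L where "L w = Max (insert c (v ` A w))" for w
  define B where "B w = {x. r' w x \<and> (\<forall>z\<in>A w. \<not> r' z x)}" for w
  define u where "u w = L w + d * (card (B w) / CARD('z))" for w
  have fin: "finite (A w)" for w by simp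
  have L_in: "L w \<in> insert c (v ` A w)" for w unfolding L_def by (rule Max_in) auto
  then have L_in': "L w \<in> insert c (range v)" for w by blast
  have L_ge: "z \<in> A w \<Longrightarrow> v z \<le> L w" for z w unfolding L_def by (rule Max_ge) auto
  have L_c: "c \<le> L w" for w unfolding L_def by (rule Max_ge) auto
  have inc0: "0 \<le> d * (card (B w) / CARD('z))" for w using d by simp
  have inc1: "d * (card (B w) / CARD('z)) \<le> d" for w
    using d card_mono[of UNIV "B w"] by (simp add: mult_left_le field_simps)
  have Amono: "A x \<subseteq> A w" if "r' w x" for w x using that tr by (auto simp: A_def)
  have Lmono: "L x \<le> L w" if "r' w x" for w x
    unfolding L_def by (rule Max_mono) (use Amono[OF that] in auto)
  \<comment> \<open>Since \<open>L x\<close> is at least \<open>v z > c\<close>, it is the value of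
    some \<open>z'\<close> in \<open>A x\<close>. Then \<open>weak\<close> ranks \<open>z'\<close>
    above \<open>z\<close> in \<open>r'\<close>, so \<open>x\<close> beats whatever \<open>w\<close>
    beats in \<open>F\<close>.\<close>
  have Aeq: "A x = A w" if wx: "r' w x" and LL: "L w = L x" for w x
  proof (rule antisym[OF Amono[OF wx]], rule subsetI)
    fix z assume z: "z \<in> A w"
    then have "v z \<le> L x" using L_ge[of z w] LL by simp
    then obtain z' where z': "z' \<in> A x" "v z \<le> v z'"
      using L_in[of x] cv[of z] by auto
    then have "r' z' z" using weak[of z' z] z FE v by (auto simp: A_def)
    then show "z \<in> A x" using z z' tr by (auto simp: A_def)
  qed
  have mono: "u x \<le> u w \<and> (\<not> r' x w \<longrightarrow> u x < u w)" if wx: "r' w x" for w x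
  proof (cases "L w = L x")
    case True
    have sub: "B x \<subseteq> B w" using Aeq[OF wx True] wx tr by (auto simp: B_def)
    then have le: "card (B x) \<le> card (B w)" by (intro card_mono) auto
    have lt: "card (B x) < card (B w)" if n: "\<not> r' x w"
    proof -
      have "w \<in> B w"
        using n Aeq[OF wx True] tr rfl by (auto simp: B_def A_def)
      moreover have "w \<notin> B x" using n by (auto simp: B_def)
      ultimately have "B x \<subset> B w" using sub by blast
      then show ?thesis by (intro psubset_card_mono) auto
    qed
    show ?thesis using le lt d True by (auto simp: u_def divide_right_mono divide_strict_right_mono)
  next
    case False
    then have "L x + d < L w" using Lmono[OF wx] gap L_in' by auto
    then show ?thesis using inc0[of w] inc1[of x] by (auto simp: u_def)
  qed
  show ?thesis
  proof (rule that[of u])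
    show "r' x y \<longleftrightarrow> u x \<ge> u y" for x y
      using mono[of x y] mono[of y x] tot[of x y] by auto
    have "L w \<in> \<rat>" for w using L_in[of w] cQ v(2) by auto
    then show "u x \<in> \<rat>" for x using d by (simp add: u_def)
    show "u z = v z" if z: "z \<in> F" for z
    proof -
      have "B z = {}" using z rfl by (auto simp: B_def A_def)
      moreover have "v z \<le> L z" using z rfl by (intro L_ge) (auto simp: A_def)
      moreover have "L z \<le> v z"
      proof -
        have "v x \<le> v z" if "x \<in> A z" for x
          using that z FE strict[of x z] v by (force simp: A_def)
        then show ?thesis using L_in[of z] cv[of z] by auto
      qed
      ultimately show ?thesis by (simp add: u_def)
    qed
    show "u w \<le> v w" if w: "w \<in> E" for w
    proof (cases "L w < v w")
      case True
      then have "L w + d < v w" using gap L_in' by auto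
      then show ?thesis using inc1[of w] by (simp add: u_def)
    next
      case False
      \<comment> \<open>Here \<open>z\<close> and \<open>w\<close> are equivalent under
        \<open>r'\<close>: one direction is membership in \<open>A w\<close>, the other follows from
        \<open>weak\<close>. So \<open>w\<close> gets no increment, and \<open>strict\<close>
        excludes \<open>v w < v z\<close>.\<close>
      then obtain z where z: "z \<in> A w" "v w \<le> v z" "L w = v z"
        using L_in[of w] cv[of w] by auto
      have zw: "r' z w" using z w v weak[of z w] by (auto simp: A_def)
      have "B w = {}" using z zw tr by (auto simp: B_def)
      moreover have "v z \<le> v w" using z w v strict[of z w] by (force simp: A_def)
      ultimately show ?thesis using z by (simp add: u_def)
    qed
  qed
qed

lemma Omega_rat_nonempty:
  fixes r :: "'i \<Rightarrow> 'z::finite \<Rightarrow> 'z \<Rightarrow> bool"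
  assumes "\<And>i. complete_preorder (r i)"
  shows "Omega r \<rat> \<noteq> {}"
proof -
  have "\<exists>v :: 'z \<Rightarrow> real. (\<forall>x y. r i x y \<longleftrightarrow> v x \<ge> v y) \<and> (\<forall>x. v x \<in> \<rat>)" for i
    \<comment> \<open>With \<open>F\<close> and \<open>E\<close> empty the comparison with
      \<open>v\<close> is void, and a plain rational representation of \<open>r i\<close>
      remains.\<close>
    by (rule rational_representation_below[OF assms[of i], of "\<lambda>_ _. True" "\<lambda>_. 0" "{}" "{}"]) (blast | simp)+
  then obtain v :: "'i \<Rightarrow> 'z \<Rightarrow> real" where "\<And>i x y. r i x y \<longleftrightarrow> v i x \<ge> v i y" "\<And>i x. v i x \<in> \<rat>" by metis
  then have "v \<in> Omega r \<rat>" by (auto simp: Omega_def)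
  then show ?thesis by blast
qed


section \<open>The canonical mechanism\<close>

lemma outcome_pure_profile:
  "outcome g (\<lambda>i. return_pmf (x i)) = g x"
  by (simp add: outcome_def Pi_pmf_return_pmf bind_return_pmf)

lemma MNE_pureI:
  assumes "\<And>i. x i \<in> M i"
    and "\<And>i a. a \<in> M i \<Longrightarrow> eu u i (g (x(i := a))) \<le> eu u i (g x)"
  shows "(\<lambda>i. return_pmf (x i)) \<in> MNE M g u"
proof -
  have "eu u i (outcome g ((\<lambda>i. return_pmf (x i))(i := mu))) \<le> eu u i (g x)"
    if mu: "set_pmf mu \<subseteq> M i" for i mu
  proof -
    have "(\<lambda>i. return_pmf (x i))(i := return_pmf a) = (\<lambda>j. return_pmf ((x(i := a)) j))" for a
      by auto
    then have "eu u i (outcome g ((\<lambda>i. return_pmf (x i))(i := mu))) =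
        measure_pmf.expectation mu (\<lambda>a. eu u i (g (x(i := a))))"
      by (subst eu_outcome_fun_upd) (simp only: outcome_pure_profile)
    also have "\<dots> \<le> measure_pmf.expectation mu (\<lambda>_. eu u i (g x))"
      using mu assms(2) by (intro integral_mono_AE) (auto simp: AE_measure_pmf_iff integrable_eu)
    finally show ?thesis by simp
  qed
  then show ?thesis using assms(1) by (auto simp: MNE_def mixed_profile_def outcome_pure_profile)
qed

text \<open>The noise \<open>N\<close> keeps weight \<open>1 / (k + 1)\<close>: all of it at level
  zero, and never none. Its support therefore always survives, while the payoff tends to that of
  \<open>A\<close>.\<close>

definition ladder :: "nat \<Rightarrow> 'a pmf \<Rightarrow> 'a pmf \<Rightarrow> 'a pmf" where
  "ladder k A N = pmix (k / (k + 1)) A N"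

lemma eu_ladder: "eu u i (ladder k A N) = (k * eu u i A + eu u i N) / (k + 1)"
proof -
  have "1 - real k / (real k + 1) = 1 / (real k + 1)" by (simp add: field_simps)
  then show ?thesis unfolding ladder_def by (subst eu_pmix) (auto simp: add_divide_distrib)
qed

lemma set_ladder_subset: "set_pmf (ladder k A N) \<subseteq> set_pmf A \<union> set_pmf N"
  by (simp add: ladder_def set_pmix_subset)

lemma set_ladder_noise: "set_pmf N \<subseteq> set_pmf (ladder k A N)"
  unfolding ladder_def by (rule set_pmix_right) auto

lemma ladder_limit: "(\<lambda>k. (real (Suc k) * x + y) / (real (Suc k) + 1)) \<longlonglongrightarrow> x"
proof -
  have "(\<lambda>k. x + (y - x) / real (k + 2)) \<longlonglongrightarrow> x + 0"
    by (intro tendsto_intros LIMSEQ_ignore_initial_segment[OF lim_const_over_n])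
  moreover have "x + (y - x) / real (k + 2) = (real (Suc k) * x + y) / (real (Suc k) + 1)" for k
    by (simp add: field_simps)
  ultimately show ?thesis by simp
qed

text \<open>Reported state, level (zero for conformity), the integer that tames the offers made to other
  agents, the offer chosen against each consensus, and the outcome wanted in the integer game.\<close>

datatype ('th, 'z) msg = Msg (st: 'th) (lev: nat) (prec: nat) (rule: "'th \<Rightarrow> 'z \<times> 'z \<times> 'z \<times> 'z") (fav: 'z)

text \<open>The ordinal conditions behind the mechanism. \<open>Zs\<close> stands for the reachable
  outcomes and \<open>E i \<theta>\<close> for those open to a single deviator \<open>i\<close> from
  consensus on \<theta>. \<open>E_spread\<close> supplies either indifference on
  \<open>E i \<theta>\<close> or a strict loss starting in \<open>F \<theta>\<close>, from which
  offers are built. \<open>indifferent\<close> and \<open>no_veto\<close> deal with disagreement in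
  equilibrium, and \<open>monotone\<close>, a form of Maskin monotonicity, with unanimity on a false
  state.\<close>

locale canonical =
  fixes Th :: "'th set"
    and R :: "'th \<Rightarrow> 'i::finite \<Rightarrow> 'z::finite \<Rightarrow> 'z \<Rightarrow> bool"
    and F :: "'th \<Rightarrow> 'z set"
    and Zs :: "'z set"
    and E :: "'i \<Rightarrow> 'th \<Rightarrow> 'z set"
  assumes card_agents: "CARD('i) \<ge> 3"
    and Th: "finite Th" "Th \<noteq> {}"
    and F_ne: "\<And>\<theta>. \<theta> \<in> Th \<Longrightarrow> F \<theta> \<noteq> {}"
    and F_E: "\<And>\<theta> i. \<theta> \<in> Th \<Longrightarrow> F \<theta> \<subseteq> E i \<theta>"
    and E_Zs: "\<And>\<theta> i. \<theta> \<in> Th \<Longrightarrow> E i \<theta> \<subseteq> Zs"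
    and E_spread: "\<And>\<theta> i. \<theta> \<in> Th \<Longrightarrow> (\<forall>x\<in>E i \<theta>. \<forall>y\<in>E i \<theta>. R \<theta> i x y) \<or>
        (\<exists>z\<in>F \<theta>. \<exists>w\<in>E i \<theta>. R \<theta> i z w \<and> \<not> R \<theta> i w z)"
    and indifferent: "\<And>\<theta>. \<theta> \<in> Th \<Longrightarrow> \<forall>i. \<forall>x\<in>Zs. \<forall>y\<in>Zs. R \<theta> i x y \<Longrightarrow> Zs \<subseteq> F \<theta>"
    and no_veto: "\<And>\<theta> \<theta>' j. \<theta> \<in> Th \<Longrightarrow> \<theta>' \<in> Th \<Longrightarrow>
        \<forall>i. i \<noteq> j \<longrightarrow> (\<forall>x\<in>E j \<theta>. \<forall>y\<in>Zs. R \<theta>' i x y) \<Longrightarrow>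
        \<forall>x\<in>E j \<theta>. \<forall>y\<in>E j \<theta>. R \<theta>' j x y \<Longrightarrow> E j \<theta> \<subseteq> F \<theta>'"
    and monotone: "\<And>\<theta> \<theta>'. \<theta> \<in> Th \<Longrightarrow> \<theta>' \<in> Th \<Longrightarrow>
        \<forall>i. (\<forall>z\<in>F \<theta>. \<forall>w\<in>E i \<theta>. R \<theta>' i z w) \<or>
            (\<forall>z\<in>F \<theta>. \<forall>w\<in>E i \<theta>. R \<theta> i z w \<longrightarrow> R \<theta>' i z w \<and> (\<not> R \<theta> i w z \<longrightarrow> \<not> R \<theta>' i w z)) \<Longrightarrow>
        F \<theta> \<subseteq> F \<theta>'"
begin

lemma third_agent: obtains l :: 'i where "l \<noteq> i" "l \<noteq> j"
proof -
  have "card {i, j} \<le> 2" by (simp add: card_insert_if)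
  then have "{i, j} \<noteq> UNIV" using card_agents by auto
  then show ?thesis using that by blast
qed

text \<open>A strict loss from \<open>z\<close> to \<open>w\<close> pays for an arbitrary second
  move from \<open>f\<close> to \<open>t\<close>; a mere indifference admits no second move, encoded
  by \<open>t = f\<close>. Either way the offer is not profitable for \<open>i\<close> in state
  \<theta> once the integer is large.\<close>

definition valid :: "'i \<Rightarrow> 'th \<Rightarrow> 'z \<times> 'z \<times> 'z \<times> 'z \<Rightarrow> bool" where
  "valid i \<theta> = (\<lambda>(z, w, f, t). z \<in> F \<theta> \<and> f \<in> F \<theta> \<and> w \<in> E i \<theta> \<and> t \<in> E i \<theta> \<and> R \<theta> i z w \<and>
     (\<not> R \<theta> i w z \<or> t = f))"

text \<open>Relative to the uniform lottery on \<open>F \<theta>\<close>, move mass from \<open>z\<close> to \<open>w\<close>, a loss in state \<open>\<theta>\<close>,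
  and \<open>1 / (K + 1)\<close> times that mass from \<open>f\<close> to \<open>t\<close>, possibly a gain. If the loss is strict, it
  dominates for all large \<open>K\<close>, whatever the cardinal utility is.\<close>

definition lott :: "'th \<Rightarrow> 'z \<times> 'z \<times> 'z \<times> 'z \<Rightarrow> nat \<Rightarrow> 'z pmf" where
  "lott \<theta> = (\<lambda>(z, w, f, t) K. pmix (1/2) (redirect z w (pmf_of_set (F \<theta>)))
     (pmix (1 / (K + 1)) (redirect f t (pmf_of_set (F \<theta>))) (pmf_of_set (F \<theta>))))"

definition sel :: "'i \<Rightarrow> 'th \<Rightarrow> nat \<Rightarrow> 'z \<times> 'z \<times> 'z \<times> 'z \<Rightarrow> 'z pmf" where
  "sel i \<theta> K l = (if valid i \<theta> l then lott \<theta> l K else pmf_of_set (F \<theta>))"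

text \<open>Averaging over all quadruples serves two purposes: the support becomes all of
  \<open>E i \<theta>\<close>, and the payoff is the mean over the offers, which equals their
  maximum only if all offers are equally good.\<close>

definition noise :: "'i \<Rightarrow> 'th \<Rightarrow> nat \<Rightarrow> 'z pmf" where
  "noise i \<theta> K = bind_pmf (pmf_of_set UNIV) (sel i \<theta> K)"

definition unan :: "'th \<Rightarrow> ('i \<Rightarrow> ('th, 'z) msg) \<Rightarrow> bool" where
  "unan \<theta> m \<longleftrightarrow> (\<forall>j. st (m j) = \<theta> \<and> lev (m j) = 0)"

text \<open>The message of \<open>i\<close> is left free, so \<open>i\<close> cannot influence this
  event. Under unanimity it holds for every agent.\<close>

definition agree :: "'i \<Rightarrow> 'th \<Rightarrow> ('i \<Rightarrow> ('th, 'z) msg) \<Rightarrow> bool" where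
  "agree i \<theta> m \<longleftrightarrow> (\<forall>j. j \<noteq> i \<longrightarrow> st (m j) = \<theta> \<and> lev (m j) = 0)"

definition others_prec :: "'i \<Rightarrow> ('i \<Rightarrow> ('th, 'z) msg) \<Rightarrow> nat" where
  "others_prec i m = (\<Sum>j\<in>-{i}. prec (m j))"

text \<open>Both uses of \<open>THE\<close> are meaningful: a unanimous state is unique, and with
  three agents so is the pair of deviator and consensus outside unanimity. \<open>SOME\<close>
  breaks ties for the highest level.\<close>

definition G :: "('i \<Rightarrow> ('th, 'z) msg) \<Rightarrow> 'z pmf" where
  "G m = (if \<exists>\<theta>. unan \<theta> m then pmf_of_set (F (THE \<theta>. unan \<theta> m))
     else if \<exists>p. agree (fst p) (snd p) m then
       (let (i, \<theta>) = THE p. agree (fst p) (snd p) m in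
         ladder (lev (m i)) (sel i \<theta> (others_prec i m) (rule (m i) \<theta>)) (noise i \<theta> (others_prec i m)))
     else (let i = SOME i. \<forall>j. lev (m j) \<le> lev (m i) in
         ladder (lev (m i)) (return_pmf (fav (m i))) (pmf_of_set Zs)))"

text \<open>Rules are extensional on the finite set \<open>Th\<close>, so there are only finitely
  many of them and messages remain countable.\<close>

definition Msgs :: "('th, 'z) msg set" where
  "Msgs = {a. st a \<in> Th \<and> rule a \<in> Th \<rightarrow>\<^sub>E UNIV \<and> fav a \<in> Zs}"

lemma Zs_ne: "Zs \<noteq> {}"
  using Th F_ne F_E E_Zs by fastforce

lemma countable_Msgs: "countable Msgs"
proof -
  let ?h = "\<lambda>(t, k, K, r, b). Msg t k K r b"
  have "Msgs \<subseteq> ?h ` (Th \<times> UNIV \<times> UNIV \<times> (Th \<rightarrow>\<^sub>E UNIV) \<times> Zs)"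
  proof
    fix a assume "a \<in> Msgs"
    then show "a \<in> ?h ` (Th \<times> UNIV \<times> UNIV \<times> (Th \<rightarrow>\<^sub>E UNIV) \<times> Zs)"
      by (cases a) (force simp: Msgs_def)
  qed
  moreover have "countable (Th \<times> (UNIV::nat set) \<times> (UNIV::nat set) \<times>
      (Th \<rightarrow>\<^sub>E (UNIV::('z \<times> 'z \<times> 'z \<times> 'z) set)) \<times> Zs)"
    using countable_finite[OF Th(1)] by (intro countable_SIGMA countable_PiE Th(1)) (auto intro: countable_finite)
  ultimately show ?thesis using countable_subset countable_image by metis
qed

lemma Msg_in_Msgs: "\<theta> \<in> Th \<Longrightarrow> b \<in> Zs \<Longrightarrow> Msg \<theta> k K (restrict r Th) b \<in> Msgs"
  by (simp add: Msgs_def)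

section \<open>Payoffs and supports of the offers\<close>

lemma eu_lott:
  assumes \<theta>: "\<theta> \<in> Th" and zf: "z \<in> F \<theta>" "f \<in> F \<theta>"
  shows "eu u i (lott \<theta> (z, w, f, t) K) = eu u i (pmf_of_set (F \<theta>)) +
    ((u i w - u i z) + (u i t - u i f) / (K + 1)) / (2 * card (F \<theta>))"
proof -
  have p: "pmf (pmf_of_set (F \<theta>)) x = 1 / card (F \<theta>)" if "x \<in> F \<theta>" for x
    using that F_ne[OF \<theta>] by simp
  define U c where "U = eu u i (pmf_of_set (F \<theta>))" and "c = 1 / real (card (F \<theta>))"
  define q where "q = 1 / (real K + 1)"
  have q: "0 \<le> q" "q \<le> 1" by (auto simp: q_def)
  have "eu u i (lott \<theta> (z, w, f, t) K) = U + ((u i w - u i z) + (u i t - u i f) * q) * c / 2"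
    unfolding lott_def using q
    by (simp add: eu_pmix eu_redirect p zf flip: U_def c_def q_def) (simp add: field_simps)
  then show ?thesis by (simp add: U_def c_def q_def add.commute mult.commute)
qed

lemma eu_sel_valid:
  assumes "\<theta> \<in> Th" "valid i \<theta> (z, w, f, t)"
  shows "eu u i (sel i \<theta> K (z, w, f, t)) = eu u i (pmf_of_set (F \<theta>)) +
    ((u i w - u i z) + (u i t - u i f) / (K + 1)) / (2 * card (F \<theta>))"
proof -
  have "sel i \<theta> K (z, w, f, t) = lott \<theta> (z, w, f, t) K" using assms by (simp add: sel_def)
  then show ?thesis
    using assms by (simp only:, intro eu_lott) (auto simp: valid_def)
qed

text \<open>A quadruple without movement changes nothing if valid and defaults to the uniform
  lottery otherwise. Conformity can thus be treated as one of the offers.\<close>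

lemma eu_sel_null:
  assumes "\<theta> \<in> Th"
  shows "eu u i (sel i \<theta> K (z, z, z, z)) = eu u i (pmf_of_set (F \<theta>))"
  using assms eu_sel_valid[of \<theta> i z z z z u K] by (cases "valid i \<theta> (z, z, z, z)") (auto simp: sel_def)

lemma set_sel:
  assumes \<theta>: "\<theta> \<in> Th"
  shows "set_pmf (sel i \<theta> K l) \<subseteq> E i \<theta>"
proof (cases "valid i \<theta> l")
  case True
  obtain z w f t where l: "l = (z, w, f, t)" by (cases l)
  let ?U = "pmf_of_set (F \<theta>)"
  have U: "set_pmf ?U \<subseteq> E i \<theta>" using F_ne F_E \<theta> by simp
  have "set_pmf (lott \<theta> l K) \<subseteq> set_pmf (redirect z w ?U) \<union> (set_pmf (redirect f t ?U) \<union> set_pmf ?U)"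
    unfolding lott_def l by (simp, meson set_pmix_subset subset_trans Un_mono order_refl)
  then show ?thesis
    using True U set_redirect[of z w ?U] set_redirect[of f t ?U] l by (auto simp: sel_def valid_def)
next
  case False
  then show ?thesis using F_ne F_E \<theta> by (simp add: sel_def)
qed

lemma eu_noise:
  "eu u i (noise j \<theta> K) = (\<Sum>l\<in>UNIV. eu u i (sel j \<theta> K l)) / CARD('z \<times> 'z \<times> 'z \<times> 'z)"
  unfolding noise_def eu_bind by (subst integral_pmf_of_set) auto

text \<open>Every \<open>e\<close> in \<open>E i \<theta>\<close> occurs in some valid offer: as
  target of the first move if \<open>i\<close> is indifferent on \<open>E i \<theta>\<close>, and
  otherwise as target of the second move, paid for by the strict loss from
  \<open>E_spread\<close>.\<close>

lemma set_noise:
  assumes \<theta>: "\<theta> \<in> Th" and reg: "\<And>x y. R \<theta> i x y \<or> R \<theta> i y x"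
  shows "set_pmf (noise i \<theta> K) = E i \<theta>"
proof
  show "set_pmf (noise i \<theta> K) \<subseteq> E i \<theta>" using set_sel[OF \<theta>] unfolding noise_def set_bind_pmf by blast
  have U: "set_pmf (pmf_of_set (F \<theta>)) = F \<theta>" using F_ne \<theta> by simp
  show "E i \<theta> \<subseteq> set_pmf (noise i \<theta> K)"
  proof
    fix e assume e: "e \<in> E i \<theta>"
    have "\<exists>l. e \<in> set_pmf (sel i \<theta> K l)"
    proof (cases "\<forall>x\<in>E i \<theta>. \<forall>y\<in>E i \<theta>. R \<theta> i x y")
      case True
      obtain z where z: "z \<in> F \<theta>" using F_ne \<theta> by blast
      then have v: "valid i \<theta> (z, e, z, z)" using True e F_E[OF \<theta>, of i] by (auto simp: valid_def)
      have "e \<in> set_pmf (redirect z e (pmf_of_set (F \<theta>)))" by (rule redirect_target) (simp add: U z)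
      then have "e \<in> set_pmf (lott \<theta> (z, e, z, z) K)"
        unfolding lott_def prod.case by (rule set_pmix_left[THEN subsetD, rotated 2]) simp_all
      then show ?thesis using v by (intro exI[of _ "(z, e, z, z)"]) (simp add: sel_def)
    next
      case False
      then obtain z w where zw: "z \<in> F \<theta>" "w \<in> E i \<theta>" "R \<theta> i z w" "\<not> R \<theta> i w z"
        using E_spread[OF \<theta>, of i] by blast
      then have v: "valid i \<theta> (z, w, z, e)" using e by (auto simp: valid_def)
      let ?A = "redirect z e (pmf_of_set (F \<theta>))"
      have "e \<in> set_pmf ?A" by (rule redirect_target) (simp add: U zw)
      then have "e \<in> set_pmf (pmix (1 / (real K + 1)) ?A (pmf_of_set (F \<theta>)))"
        by (rule set_pmix_left[THEN subsetD, rotated 2]) simp_all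
      then have "e \<in> set_pmf (lott \<theta> (z, w, z, e) K)"
        unfolding lott_def prod.case by (rule set_pmix_right[THEN subsetD, rotated 2]) simp_all
      then show ?thesis using v by (intro exI[of _ "(z, w, z, e)"]) (simp add: sel_def)
    qed
    then show "e \<in> set_pmf (noise i \<theta> K)" by (auto simp: noise_def)
  qed
qed

section \<open>The cases of the outcome function\<close>

lemma agree_state_unique: "agree i \<theta> m \<Longrightarrow> agree i \<theta>' m \<Longrightarrow> \<theta> = \<theta>'"
  using third_agent[of i i] unfolding agree_def by metis

text \<open>A third agent belongs to both agreeing groups, so the two states coincide; each of
  \<open>i\<close> and \<open>j\<close> conforms because the other is the exempted one.\<close>

lemma agree_deviator_unique:
  assumes "agree i \<theta> m" "agree j \<theta>' m" "i \<noteq> j"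
  shows "unan \<theta> m"
proof -
  obtain l where "l \<noteq> i" "l \<noteq> j" by (rule third_agent)
  then have "\<theta>' = \<theta>" using assms unfolding agree_def by metis
  have "st (m k) = \<theta> \<and> lev (m k) = 0" for k
    using assms \<open>\<theta>' = \<theta>\<close> by (cases "k = i") (simp_all add: agree_def)
  then show ?thesis by (simp add: unan_def)
qed

lemma unan_unique: "unan \<theta> m \<Longrightarrow> unan \<theta>' m \<Longrightarrow> \<theta> = \<theta>'"
  by (auto simp: unan_def)

lemma unan_agree: "unan \<theta> m \<longleftrightarrow> agree i \<theta> m \<and> st (m i) = \<theta> \<and> lev (m i) = 0"
proof
  assume *: "agree i \<theta> m \<and> st (m i) = \<theta> \<and> lev (m i) = 0"
  have "st (m j) = \<theta> \<and> lev (m j) = 0" for j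
    using * by (cases "j = i") (simp_all add: agree_def)
  then show "unan \<theta> m" by (simp add: unan_def)
qed (simp add: unan_def agree_def)

lemma agree_upd [simp]: "agree i \<theta> (m(i := a)) = agree i \<theta> m"
  by (auto simp: agree_def)

lemma others_prec_upd [simp]: "others_prec i (m(i := a)) = others_prec i m"
  unfolding others_prec_def by (rule sum.cong) auto

lemma G_unan: "unan \<theta> m \<Longrightarrow> G m = pmf_of_set (F \<theta>)"
proof -
  assume u: "unan \<theta> m"
  then have "(THE \<theta>. unan \<theta> m) = \<theta>" by (rule the_equality) (rule unan_unique[OF _ u])
  moreover have "\<exists>\<theta>. unan \<theta> m" using u by blast
  ultimately show ?thesis by (simp add: G_def)
qed

lemma G_agree:
  assumes ag: "agree i \<theta> m" and dev: "\<not> (st (m i) = \<theta> \<and> lev (m i) = 0)"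
  shows "G m = ladder (lev (m i)) (sel i \<theta> (others_prec i m) (rule (m i) \<theta>)) (noise i \<theta> (others_prec i m))"
proof -
  have n: "\<not> unan \<theta>' m" for \<theta>'
  proof
    assume u: "unan \<theta>' m"
    then have "agree i \<theta>' m" using unan_agree by blast
    then have "\<theta>' = \<theta>" using ag by (rule agree_state_unique)
    then show False using u dev by (simp add: unan_def)
  qed
  have "(THE p. agree (fst p) (snd p) m) = (i, \<theta>)"
  proof (rule the_equality)
    fix p assume p: "agree (fst p) (snd p) m"
    then have i: "fst p = i" using ag n agree_deviator_unique[OF ag p] by blast
    then have "snd p = \<theta>" using p ag by (intro agree_state_unique[of i]) simp_all
    then show "p = (i, \<theta>)" using i by (simp add: prod_eq_iff)
  qed (use ag in simp)
  moreover have "\<exists>p. agree (fst p) (snd p) m" using ag by (intro exI[of _ "(i, \<theta>)"]) simp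
  ultimately show ?thesis using n unfolding G_def by simp
qed

lemma G_disagree:
  assumes "\<And>i \<theta>. \<not> agree i \<theta> m"
  obtains i where "\<And>j. lev (m j) \<le> lev (m i)"
    "G m = ladder (lev (m i)) (return_pmf (fav (m i))) (pmf_of_set Zs)"
proof -
  have n: "\<not> unan \<theta> m" for \<theta> using assms unan_agree by blast
  have "Max (range (\<lambda>i. lev (m i))) \<in> range (\<lambda>i. lev (m i))" by (rule Max_in) auto
  then obtain i where i: "lev (m i) = Max (range (\<lambda>i. lev (m i)))" by (metis rangeE)
  have "\<forall>j. lev (m j) \<le> lev (m i)" unfolding i by simp
  then have max: "\<forall>j. lev (m j) \<le> lev (m (SOME i. \<forall>j. lev (m j) \<le> lev (m i)))" by (rule someI)
  show ?thesis
    by (rule that[of "SOME i. \<forall>j. lev (m j) \<le> lev (m i)"])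
      (use max n assms in \<open>simp_all add: G_def Let_def\<close>)
qed

lemma set_G:
  assumes m: "\<And>j. m j \<in> Msgs"
  shows "set_pmf (G m) \<subseteq> Zs"
proof (cases "\<exists>i \<theta>. agree i \<theta> m")
  case True
  then obtain i \<theta> where ag: "agree i \<theta> m" by blast
  obtain l where "l \<noteq> i" by (rule third_agent)
  then have \<theta>: "\<theta> \<in> Th" using ag m[of l] by (auto simp: agree_def Msgs_def)
  show ?thesis
  proof (cases "st (m i) = \<theta> \<and> lev (m i) = 0")
    case True
    then show ?thesis using ag G_unan[of \<theta> m] unan_agree[of \<theta> m i] F_ne[OF \<theta>] F_E[OF \<theta>, of i] E_Zs[OF \<theta>, of i] by auto
  next
    case False
    have "set_pmf (noise i \<theta> K) \<subseteq> E i \<theta>" for K using set_sel[OF \<theta>] unfolding noise_def set_bind_pmf by blast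
    then show ?thesis
      unfolding G_agree[OF ag False] using set_ladder_subset set_sel[OF \<theta>] E_Zs[OF \<theta>, of i] by fast
  qed
next
  case False
  then obtain i where "G m = ladder (lev (m i)) (return_pmf (fav (m i))) (pmf_of_set Zs)"
    by (metis G_disagree)
  then show ?thesis
    using m[of i] set_ladder_subset[of "lev (m i)" "return_pmf (fav (m i))" "pmf_of_set Zs"] Zs_ne
    by (auto simp: Msgs_def)
qed

section \<open>Truthful reporting as an equilibrium\<close>

lemma eu_sel_le_truth:
  assumes \<theta>: "\<theta> \<in> Th" and u: "u \<in> Omega (R \<theta>) UNIV"
  shows "\<forall>\<^sub>F K in sequentially. \<forall>i l. eu u i (sel i \<theta> K l) \<le> eu u i (pmf_of_set (F \<theta>))"
proof -
  have R: "R \<theta> i x y \<longleftrightarrow> u i x \<ge> u i y" for i x y using u by (simp add: Omega_def)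
  have "\<forall>\<^sub>F K in sequentially. eu u i (sel i \<theta> K l) \<le> eu u i (pmf_of_set (F \<theta>))" for i l
  proof (cases "valid i \<theta> l")
    case True
    obtain z w f t where l: "l = (z, w, f, t)" by (cases l)
    have "\<forall>\<^sub>F K in sequentially. (u i w - u i z) + (u i t - u i f) / (real K + 1) \<le> 0"
    proof (cases "t = f")
      case True
      then show ?thesis using \<open>valid i \<theta> l\<close> R l by (auto simp: valid_def)
    next
      case False
      then have lt: "u i w < u i z" using \<open>valid i \<theta> l\<close> R l by (auto simp: valid_def)
      have "(\<lambda>K. (u i w - u i z) + (u i t - u i f) / real (K + 1)) \<longlonglongrightarrow> (u i w - u i z) + 0"
        by (intro tendsto_intros LIMSEQ_ignore_initial_segment[OF lim_const_over_n])
      then have "\<forall>\<^sub>F K in sequentially. (u i w - u i z) + (u i t - u i f) / real (K + 1) < 0"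
        by (rule order_tendstoD) (use lt in simp)
      then show ?thesis by (rule eventually_mono) (simp add: add.commute)
    qed
    then show ?thesis
    proof (rule eventually_mono)
      fix K assume "(u i w - u i z) + (u i t - u i f) / (real K + 1) \<le> 0"
      then show "eu u i (sel i \<theta> K l) \<le> eu u i (pmf_of_set (F \<theta>))"
        using eu_sel_valid[OF \<theta>, of i z w f t u K] True
          divide_nonpos_nonneg[of _ "2 * real (card (F \<theta>))"] by (simp add: l add.commute)
    qed
  next
    case False
    then show ?thesis by (simp add: sel_def)
  qed
  \<comment> \<open>Agents and offers are finite in number, so their thresholds combine into
    one.\<close>
  then show ?thesis by (simp add: eventually_all_finite)
qed

lemma eu_noise_le:
  assumes "\<And>l. eu u i (sel i \<theta> K l) \<le> c"
  shows "eu u i (noise i \<theta> K) \<le> c"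
proof -
  have "(\<Sum>l\<in>UNIV. eu u i (sel i \<theta> K l)) \<le> (\<Sum>l\<in>(UNIV::('z\<times>'z\<times>'z\<times>'z) set). c)"
    by (rule sum_mono) (rule assms)
  then show ?thesis
    unfolding eu_noise by (subst pos_divide_le_eq) (simp_all add: mult.commute)
qed

lemma truthful_equilibrium:
  assumes \<theta>: "\<theta> \<in> Th" and u: "u \<in> Omega (R \<theta>) UNIV"
  obtains a where "a \<in> Msgs" "G (\<lambda>_. a) = pmf_of_set (F \<theta>)"
    "\<And>i b. eu u i (G ((\<lambda>_. a)(i := b))) \<le> eu u i (G (\<lambda>_. a))"
proof -
  obtain K0 where K0: "\<And>K i l. K0 \<le> K \<Longrightarrow> eu u i (sel i \<theta> K l) \<le> eu u i (pmf_of_set (F \<theta>))"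
    using eu_sel_le_truth[OF \<theta> u] unfolding eventually_sequentially by blast
  obtain b where b: "b \<in> Zs" using Zs_ne by blast
  \<comment> \<open>All report the true state at level zero with the threshold \<open>K0\<close> for
    this particular \<open>u\<close>; the remaining entries are placeholders that make the message
    legal.\<close>
  define a where "a = Msg \<theta> 0 K0 (restrict (\<lambda>_. (b, b, b, b)) Th) b"
  have G0: "G (\<lambda>_. a) = pmf_of_set (F \<theta>)" by (rule G_unan) (simp add: a_def unan_def)
  have "eu u i (G ((\<lambda>_. a)(i := b))) \<le> eu u i (pmf_of_set (F \<theta>))" for i b
  proof -
    let ?m = "(\<lambda>_. a)(i := b)"
    have ag: "agree i \<theta> ?m" by (simp add: agree_def a_def)
    show ?thesis
    proof (cases "st b = \<theta> \<and> lev b = 0")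
      case True
      then have "unan \<theta> ?m" by (simp add: unan_def a_def)
      then show ?thesis by (simp add: G_unan)
    next
      case False
      obtain l where "l \<noteq> i" by (rule third_agent)
      \<comment> \<open>Another agent still announces \<open>K0\<close>, and integers are summed, so
        the deviator faces at least \<open>K0\<close>.\<close>
      then have "prec (?m l) \<le> others_prec i ?m"
        unfolding others_prec_def by (intro member_le_sum) auto
      then have K: "K0 \<le> others_prec i ?m" using \<open>l \<noteq> i\<close> by (simp add: a_def)
      let ?x = "eu u i (pmf_of_set (F \<theta>))"
      have "eu u i (noise i \<theta> (others_prec i ?m)) \<le> ?x"
        by (rule eu_noise_le) (rule K0[OF K])
      moreover have "lev b * eu u i (sel i \<theta> (others_prec i ?m) (rule b \<theta>)) \<le> lev b * ?x"
        by (intro mult_left_mono K0[OF K]) simp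
      ultimately show ?thesis
        using False by (subst G_agree[OF ag]) (auto simp: eu_ladder field_simps)
    qed
  qed
  then show ?thesis using that[of a] G0 Msg_in_Msgs[OF \<theta> b] by (simp add: a_def)
qed

end

section \<open>Equilibria of the canonical mechanism\<close>

text \<open>\<open>Q\<close> is the distribution of message profiles in an equilibrium and
  \<open>V\<close> gives the payoffs. In \<open>optimal\<close> a message \<open>m i\<close> from
  the support is tested against a fresh draw \<open>m'\<close>, as befits independent
  mixing.\<close>

locale canonical_equilibrium = canonical Th R F Zs E
  for Th :: "'th set"
    and R :: "'th \<Rightarrow> 'i::finite \<Rightarrow> 'z::finite \<Rightarrow> 'z \<Rightarrow> bool"
    and F :: "'th \<Rightarrow> 'z set"
    and Zs :: "'z set"
    and E :: "'i \<Rightarrow> 'th \<Rightarrow> 'z set" +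
  fixes Q :: "('i \<Rightarrow> ('th, 'z) msg) pmf" and u :: "'i \<Rightarrow> 'z \<Rightarrow> real" and V :: "'i \<Rightarrow> real"
    and \<theta>0 :: 'th
  assumes total: "\<And>\<theta> i x y. \<theta> \<in> Th \<Longrightarrow> R \<theta> i x y \<or> R \<theta> i y x"
    and \<theta>0: "\<theta>0 \<in> Th"
    and u: "\<And>i x y. R \<theta>0 i x y \<longleftrightarrow> u i x \<ge> u i y"
    and Q_Msgs: "\<And>m j. m \<in> set_pmf Q \<Longrightarrow> m j \<in> Msgs"
    and deviation: "\<And>i a. a \<in> Msgs \<Longrightarrow>
        measure_pmf.expectation Q (\<lambda>m. eu u i (G (m(i := a)))) \<le> V i"
    and optimal: "\<And>i m. m \<in> set_pmf Q \<Longrightarrow>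
        measure_pmf.expectation Q (\<lambda>m'. eu u i (G (m'(i := m i)))) = V i"
begin

section \<open>Payoffs split by what the other agents announce\<close>

definition part :: "'i \<Rightarrow> 'th \<Rightarrow> ('th, 'z) msg \<Rightarrow> real" where
  "part i \<theta> a = measure_pmf.expectation Q (\<lambda>m. if agree i \<theta> m then eu u i (G (m(i := a))) else 0)"

text \<open>Payoffs are restricted to the event \<open>agree i \<theta>\<close>, not conditioned on
  it, so that contingencies add up to the total payoff and those of probability zero need no special
  care.\<close>

definition menu :: "'i \<Rightarrow> 'th \<Rightarrow> 'z \<times> 'z \<times> 'z \<times> 'z \<Rightarrow> real" where
  "menu i \<theta> l = measure_pmf.expectation Q
     (\<lambda>m. if agree i \<theta> m then eu u i (sel i \<theta> (others_prec i m) l) else 0)"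

definition avg :: "'i \<Rightarrow> 'th \<Rightarrow> real" where
  "avg i \<theta> = measure_pmf.expectation Q
     (\<lambda>m. if agree i \<theta> m then eu u i (noise i \<theta> (others_prec i m)) else 0)"

definition best :: "'i \<Rightarrow> 'th \<Rightarrow> real" where
  "best i \<theta> = Max (range (menu i \<theta>))"

definition peak :: "'i \<Rightarrow> real" where
  "peak i = Max (u i ` Zs)"

definition out :: "'i \<Rightarrow> ('i \<Rightarrow> ('th, 'z) msg) \<Rightarrow> bool" where
  "out i m \<longleftrightarrow> (\<forall>\<theta>. \<not> agree i \<theta> m)"

definition rest :: "'i \<Rightarrow> ('th, 'z) msg \<Rightarrow> real" where
  "rest i a = measure_pmf.expectation Q (\<lambda>m. if out i m then eu u i (G (m(i := a))) else 0)"

definition best_rest :: "'i \<Rightarrow> real" where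
  "best_rest i = measure_pmf.expectation Q (\<lambda>m. if out i m then peak i else 0)"

lemma integrable_if_eu: "integrable (measure_pmf Q) (\<lambda>m. if P m then eu u i (f m) else 0)"
  by (rule integrable_pmf_bounded[of _ "\<Sum>z\<in>UNIV. \<bar>u i z\<bar>"]) (simp add: eu_bounded sum_nonneg)

lemma integrable_if_const: "integrable (measure_pmf Q) (\<lambda>m. if P m then c else (0::real))"
  by (rule integrable_pmf_bounded[of _ "\<bar>c\<bar>"]) simp

lemma agree_Th: "m \<in> set_pmf Q \<Longrightarrow> agree i \<theta> m \<Longrightarrow> \<theta> \<in> Th"
proof -
  assume *: "m \<in> set_pmf Q" "agree i \<theta> m"
  obtain l where "l \<noteq> i" by (rule third_agent)
  then show ?thesis using * Q_Msgs[OF *(1), of l] by (auto simp: agree_def Msgs_def)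
qed

lemma payoff_split:
  "measure_pmf.expectation Q (\<lambda>m. eu u i (G (m(i := a)))) = (\<Sum>\<theta>\<in>Th. part i \<theta> a) + rest i a"
proof -
  have "measure_pmf.expectation Q (\<lambda>m. eu u i (G (m(i := a)))) =
    measure_pmf.expectation Q (\<lambda>m. (\<Sum>\<theta>\<in>Th. if agree i \<theta> m then eu u i (G (m(i := a))) else 0) +
      (if out i m then eu u i (G (m(i := a))) else 0))"
  proof (rule integral_cong_AE)
    have "eu u i (G (m(i := a))) = (\<Sum>\<theta>\<in>Th. if agree i \<theta> m then eu u i (G (m(i := a))) else 0) +
      (if out i m then eu u i (G (m(i := a))) else 0)" if m: "m \<in> set_pmf Q" for m
    proof (cases "out i m")
      case True
      then show ?thesis by (simp add: out_def)
    next
      case False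
      then obtain \<theta> where \<theta>: "agree i \<theta> m" by (auto simp: out_def)
      have "(agree i \<theta>' m) = (\<theta> = \<theta>')" for \<theta>' using \<theta> agree_state_unique by blast
      then show ?thesis using False agree_Th[OF m \<theta>] Th(1) by simp
    qed
    then show "AE m in measure_pmf Q. eu u i (G (m(i := a))) =
      (\<Sum>\<theta>\<in>Th. if agree i \<theta> m then eu u i (G (m(i := a))) else 0) +
      (if out i m then eu u i (G (m(i := a))) else 0)"
      by (simp add: AE_measure_pmf_iff)
  qed simp_all
  also have "\<dots> = (\<Sum>\<theta>\<in>Th. part i \<theta> a) + rest i a"
    unfolding part_def rest_def
    by (simp add: integrable_if_eu)
  finally show ?thesis .
qed

lemma avg_eq: "avg i \<theta> = (\<Sum>l\<in>UNIV. menu i \<theta> l) / CARD('z \<times> 'z \<times> 'z \<times> 'z)"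
proof -
  have "avg i \<theta> = measure_pmf.expectation Q (\<lambda>m. (\<Sum>l\<in>UNIV.
      if agree i \<theta> m then eu u i (sel i \<theta> (others_prec i m) l) else 0) / CARD('z \<times> 'z \<times> 'z \<times> 'z))"
    unfolding avg_def by (rule Bochner_Integration.integral_cong) (simp_all add: eu_noise)
  also have "\<dots> = (\<Sum>l\<in>UNIV. menu i \<theta> l) / CARD('z \<times> 'z \<times> 'z \<times> 'z)"
    unfolding menu_def
    by (subst integral_divide_zero, subst Bochner_Integration.integral_sum)
       (rule integrable_if_eu refl)+
  finally show ?thesis .
qed

lemma menu_le_best: "menu i \<theta> l \<le> best i \<theta>"
  unfolding best_def by (rule Max_ge) auto

lemma sum_menu_le: "(\<Sum>l\<in>UNIV. menu i \<theta> l) \<le> CARD('z \<times> 'z \<times> 'z \<times> 'z) * best i \<theta>"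
  using sum_mono[of UNIV "menu i \<theta>" "\<lambda>_. best i \<theta>"] menu_le_best by simp

lemma avg_le_best: "avg i \<theta> \<le> best i \<theta>"
  using sum_menu_le[of i \<theta>] unfolding avg_eq
  by (subst pos_divide_le_eq) (simp_all add: mult.commute)

lemma avg_eq_best:
  assumes "avg i \<theta> = best i \<theta>"
  shows "menu i \<theta> l = best i \<theta>"
proof -
  have "(\<Sum>l\<in>UNIV. menu i \<theta> l) = CARD('z \<times> 'z \<times> 'z \<times> 'z) * best i \<theta>"
    using assms unfolding avg_eq by (subst (asm) divide_eq_eq) (simp add: mult.commute)
  then have "(\<Sum>l\<in>UNIV. best i \<theta> - menu i \<theta> l) = 0"
    by (simp add: sum_subtractf)
  then have "\<forall>l\<in>UNIV. best i \<theta> - menu i \<theta> l = 0"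
    by (subst (asm) sum_nonneg_eq_0_iff) (auto simp: menu_le_best)
  then have "best i \<theta> - menu i \<theta> l = 0" by blast
  then show ?thesis by simp
qed

lemma part_truth:
  assumes "\<theta> \<in> Th" "st a = \<theta>" "lev a = 0"
  shows "part i \<theta> a = menu i \<theta> (x, x, x, x)"
  unfolding part_def menu_def
proof (rule Bochner_Integration.integral_cong)
  fix m
  show "(if agree i \<theta> m then eu u i (G (m(i := a))) else 0) =
    (if agree i \<theta> m then eu u i (sel i \<theta> (others_prec i m) (x, x, x, x)) else 0)"
  proof (cases "agree i \<theta> m")
    case True
    then have "unan \<theta> (m(i := a))" using assms by (subst unan_agree[of _ _ i]) simp
    then show ?thesis using True by (simp add: G_unan eu_sel_null assms)
  qed simp
qed simp

lemma part_deviation: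
  assumes "\<not> (st a = \<theta> \<and> lev a = 0)"
  shows "part i \<theta> a = (lev a * menu i \<theta> (rule a \<theta>) + avg i \<theta>) / (lev a + 1)"
proof -
  have "part i \<theta> a = measure_pmf.expectation Q (\<lambda>m.
      (lev a * (if agree i \<theta> m then eu u i (sel i \<theta> (others_prec i m) (rule a \<theta>)) else 0) +
      (if agree i \<theta> m then eu u i (noise i \<theta> (others_prec i m)) else 0)) / (lev a + 1))"
    unfolding part_def
  proof (rule Bochner_Integration.integral_cong)
    fix m
    show "(if agree i \<theta> m then eu u i (G (m(i := a))) else 0) =
      (lev a * (if agree i \<theta> m then eu u i (sel i \<theta> (others_prec i m) (rule a \<theta>)) else 0) +
      (if agree i \<theta> m then eu u i (noise i \<theta> (others_prec i m)) else 0)) / (lev a + 1)"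
    proof (cases "agree i \<theta> m")
      case True
      then have "agree i \<theta> (m(i := a))" by simp
      from G_agree[OF this] show ?thesis using True assms by (simp add: eu_ladder add.commute)
    qed simp
  qed simp
  also have "\<dots> = (lev a * menu i \<theta> (rule a \<theta>) + avg i \<theta>) / (lev a + 1)"
    unfolding menu_def avg_def
    by (subst integral_divide_zero, subst Bochner_Integration.integral_add)
       (simp_all add: integrable_if_eu)
  finally show ?thesis .
qed

lemma part_le_best: "\<theta> \<in> Th \<Longrightarrow> part i \<theta> a \<le> best i \<theta>"
proof (cases "st a = \<theta> \<and> lev a = 0")
  case True
  then show "\<theta> \<in> Th \<Longrightarrow> ?thesis" using part_truth menu_le_best by metis
next
  case False
  have "lev a * menu i \<theta> (rule a \<theta>) \<le> lev a * best i \<theta>"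
    by (intro mult_left_mono menu_le_best) simp
  then show ?thesis
    unfolding part_deviation[OF False] using avg_le_best[of i \<theta>]
    by (subst pos_divide_le_eq) (simp_all add: algebra_simps)
qed

lemma peak_ge: "z \<in> Zs \<Longrightarrow> u i z \<le> peak i"
  unfolding peak_def by (rule Max_ge) auto

lemma eu_G_le_peak: "(\<And>j. m j \<in> Msgs) \<Longrightarrow> eu u i (G m) \<le> peak i"
  using set_G[of m] by (intro eu_le peak_ge) blast

lemma rest_le: "a \<in> Msgs \<Longrightarrow> rest i a \<le> best_rest i"
  unfolding rest_def best_rest_def
  by (rule integral_mono_AE)
    (auto simp: integrable_if_eu integrable_if_const AE_measure_pmf_iff Q_Msgs intro!: eu_G_le_peak)

text \<open>Announcing ever higher levels, an agent approaches the best conceivable payoff, so an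
  equilibrium message must attain it, in each contingency separately.\<close>

lemma best_le_payoff: "(\<Sum>\<theta>\<in>Th. best i \<theta>) + best_rest i \<le> V i"
proof -
  have "peak i \<in> u i ` Zs" unfolding peak_def using Zs_ne by (intro Max_in) auto
  then obtain b where b: "b \<in> Zs" "u i b = peak i" by auto
  have "\<exists>l. menu i \<theta> l = best i \<theta>" for \<theta>
  proof -
    have "best i \<theta> \<in> range (menu i \<theta>)" unfolding best_def by (rule Max_in) auto
    then show ?thesis by (metis rangeE)
  qed
  then obtain r where r: "\<And>\<theta>. menu i \<theta> (r \<theta>) = best i \<theta>" by metis
  \<comment> \<open>Level \<open>Suc k\<close> is never zero, so this message never conforms. Its
    rule takes a best offer against every possible consensus at once, and \<open>b\<close> is a
    favourite of \<open>i\<close> in \<open>Zs\<close>.\<close>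
  define d where "d k = Msg \<theta>0 (Suc k) 0 (restrict r Th) b" for k
  have d: "d k \<in> Msgs" for k unfolding d_def by (rule Msg_in_Msgs[OF \<theta>0 b(1)])
  have part: "(\<lambda>k. part i \<theta> (d k)) \<longlonglongrightarrow> best i \<theta>" if "\<theta> \<in> Th" for \<theta>
  proof -
    have "part i \<theta> (d k) = (real (Suc k) * best i \<theta> + avg i \<theta>) / (real (Suc k) + 1)" for k
      using that r by (subst part_deviation) (simp_all add: d_def)
    then show ?thesis using ladder_limit by presburger
  qed
  have rest: "(\<lambda>k. rest i (d k)) \<longlonglongrightarrow> best_rest i"
    unfolding rest_def best_rest_def
  proof (rule integral_dominated_convergence[where w = "\<lambda>_. \<Sum>z\<in>UNIV. \<bar>u i z\<bar>"])
    show "AE m in measure_pmf Q. (\<lambda>k. if out i m then eu u i (G (m(i := d k))) else 0)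
        \<longlonglongrightarrow> (if out i m then peak i else 0)"
    proof (rule AE_I2)
      fix m
      show "(\<lambda>k. if out i m then eu u i (G (m(i := d k))) else 0) \<longlonglongrightarrow> (if out i m then peak i else 0)"
      proof (cases "out i m")
        case True
        define e where "e = eu u i (pmf_of_set Zs)"
        \<comment> \<open>Once \<open>k\<close> reaches all levels in \<open>m\<close>,
          \<open>Suc k\<close> exceeds them strictly and \<open>i\<close> alone wins. Nobody else
          passes for the single deviator, since the level of \<open>i\<close> is positive.\<close>
        have "eu u i (G (m(i := d k))) = (real (Suc k) * peak i + e) / (real (Suc k) + 1)"
          if k: "k \<ge> Max (range (\<lambda>j. lev (m j)))" for k
        proof -
          let ?m = "m(i := d k)"
          have lk: "lev (m j) \<le> k" for j
            using k Max_ge[of "range (\<lambda>j. lev (m j))" "lev (m j)"] by simp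
          have "\<not> agree j \<theta> ?m" for j \<theta>
          proof
            assume ag: "agree j \<theta> ?m"
            show False
            proof (cases "j = i")
              case True
              then show False using ag \<open>out i m\<close> by (simp add: out_def)
            next
              case False
              then have "lev (?m i) = 0" using ag unfolding agree_def by metis
              then show False by (simp add: d_def)
            qed
          qed
          then obtain w where w: "\<And>j. lev (?m j) \<le> lev (?m w)"
            "G ?m = ladder (lev (?m w)) (return_pmf (fav (?m w))) (pmf_of_set Zs)"
            by (rule G_disagree) blast
          have "w = i"
          proof (rule ccontr)
            assume "w \<noteq> i"
            then show False using w(1)[of i] lk[of w] by (simp add: d_def)
          qed
          then show ?thesis using b w(2) by (simp add: d_def eu_ladder e_def)
        qed
        then have "\<forall>\<^sub>F k in sequentially. (real (Suc k) * peak i + e) / (real (Suc k) + 1) =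
            eu u i (G (m(i := d k)))"
          unfolding eventually_sequentially by metis
        then have "(\<lambda>k. eu u i (G (m(i := d k)))) \<longlonglongrightarrow> peak i"
          using ladder_limit by (rule Lim_transform_eventually[rotated])
        then show ?thesis using True by simp
      qed simp
    qed
    show "AE m in measure_pmf Q. norm (if out i m then eu u i (G (m(i := d k))) else 0)
        \<le> (\<Sum>z\<in>UNIV. \<bar>u i z\<bar>)" for k
      by (simp add: eu_bounded sum_nonneg)
  qed simp_all
  have "(\<lambda>k. (\<Sum>\<theta>\<in>Th. part i \<theta> (d k)) + rest i (d k)) \<longlonglongrightarrow> (\<Sum>\<theta>\<in>Th. best i \<theta>) + best_rest i"
    by (intro tendsto_add tendsto_sum part rest)
  moreover have "(\<Sum>\<theta>\<in>Th. part i \<theta> (d k)) + rest i (d k) \<le> V i" for k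
    using deviation[OF d] by (simp add: payoff_split)
  ultimately show ?thesis by (intro LIMSEQ_le_const2) auto
qed

text \<open>No contingency contributes more than its bound, yet the bounds together do not exceed
  the total contribution \<open>V i\<close>, so each is met with equality.\<close>

lemma
  assumes m: "m \<in> set_pmf Q"
  shows part_best: "\<theta> \<in> Th \<Longrightarrow> part i \<theta> (m i) = best i \<theta>"
    and rest_best: "rest i (m i) = best_rest i"
proof -
  have "(\<Sum>\<theta>\<in>Th. best i \<theta> - part i \<theta> (m i)) + (best_rest i - rest i (m i)) \<le> 0"
    using optimal[OF m, of i] best_le_payoff[of i] by (simp add: payoff_split sum_subtractf)
  moreover have "0 \<le> (\<Sum>\<theta>\<in>Th. best i \<theta> - part i \<theta> (m i))"
    by (rule sum_nonneg) (simp add: part_le_best)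
  moreover have "rest i (m i) \<le> best_rest i" using rest_le Q_Msgs[OF m] by blast
  ultimately have eq: "(\<Sum>\<theta>\<in>Th. best i \<theta> - part i \<theta> (m i)) = 0" "rest i (m i) = best_rest i"
    by linarith+
  show "rest i (m i) = best_rest i" by (rule eq)
  show "part i \<theta> (m i) = best i \<theta>" if "\<theta> \<in> Th"
    using eq(1) that by (subst (asm) sum_nonneg_eq_0_iff) (auto simp: Th part_le_best)
qed

text \<open>Where \<open>out i\<close> holds, the payoff never exceeds the peak but matches it in
  expectation, hence at each profile of the support, in particular at \<open>m\<close>. A lottery on
  \<open>Zs\<close> with peak payoff contains only peak outcomes.\<close>

lemma out_peak:
  assumes m: "m \<in> set_pmf Q" and out: "out i m" and z: "z \<in> set_pmf (G m)"
  shows "u i z = peak i"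
proof -
  let ?f = "\<lambda>m'. if out i m' then eu u i (G (m'(i := m i))) else 0"
  let ?c = "\<lambda>m'. if out i m' then peak i else 0"
  have "?f m - ?c m = 0"
  proof (rule expectation_attains_bound[where f = "\<lambda>m. ?f m - ?c m" and c = 0, OF _ _ _ m])
    show "measure_pmf.expectation Q (\<lambda>m. ?f m - ?c m) = 0"
      using rest_best[OF m, of i] integrable_if_eu integrable_if_const
      by (simp add: rest_def best_rest_def)
    show "?f m' - ?c m' \<le> 0" if "m' \<in> set_pmf Q" for m'
      using eu_G_le_peak[of "m'(i := m i)" i] that m Q_Msgs by simp
  qed (intro Bochner_Integration.integrable_diff integrable_if_eu integrable_if_const)
  then have "eu u i (G m) = peak i" using out by simp
  then show ?thesis
    using eu_attains_bound[of "G m" u i "peak i" z] z peak_ge set_G[of m] Q_Msgs[OF m] by blast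
qed

section \<open>Ordinal consequences of choosing optimally among the offers\<close>

definition mass :: "'i \<Rightarrow> 'th \<Rightarrow> real" where
  "mass i \<theta> = measure_pmf.expectation Q (\<lambda>m. if agree i \<theta> m then 1 else 0)"

text \<open>The expected weight of the second move of an offer when the integers of the others are
  random. Only its positivity is used, so no cardinal information about \<open>Q\<close>
  enters.\<close>

definition thin_mass :: "'i \<Rightarrow> 'th \<Rightarrow> real" where
  "thin_mass i \<theta> = measure_pmf.expectation Q
     (\<lambda>m. if agree i \<theta> m then 1 / real (others_prec i m + 1) else 0)"

lemma integrable_thin: "integrable (measure_pmf Q) (\<lambda>m. if P m then 1 / real (k m + 1) else 0)"
  by (rule integrable_pmf_bounded[of _ 1]) auto

lemma mass_pos:
  assumes "m \<in> set_pmf Q" "agree i \<theta> m"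
  shows "mass i \<theta> > 0" "thin_mass i \<theta> > 0"
proof -
  show "mass i \<theta> > 0" unfolding mass_def
    by (rule expectation_pos[OF integrable_if_const _ assms(1)]) (simp_all add: assms(2))
  show "thin_mass i \<theta> > 0" unfolding thin_mass_def
    by (rule expectation_pos[OF integrable_thin _ assms(1)]) (simp_all add: assms(2))
qed

lemma menu_valid:
  assumes \<theta>: "\<theta> \<in> Th" and v: "valid i \<theta> (z, w, f, t)"
  shows "menu i \<theta> (z, w, f, t) = menu i \<theta> (x, x, x, x) +
    (mass i \<theta> * (u i w - u i z) + thin_mass i \<theta> * (u i t - u i f)) / (2 * real (card (F \<theta>)))"
proof -
  let ?n = "2 * real (card (F \<theta>))"
  have "menu i \<theta> (z, w, f, t) = measure_pmf.expectation Q (\<lambda>m.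
      (if agree i \<theta> m then eu u i (sel i \<theta> (others_prec i m) (x, x, x, x)) else 0) +
      ((if agree i \<theta> m then 1 else 0) * (u i w - u i z) +
       (if agree i \<theta> m then 1 / real (others_prec i m + 1) else 0) * (u i t - u i f)) / ?n)"
    unfolding menu_def
    by (rule Bochner_Integration.integral_cong)
      (simp_all add: eu_sel_valid[OF \<theta> v] eu_sel_null[OF \<theta>])
  also have "\<dots> = menu i \<theta> (x, x, x, x) +
    (mass i \<theta> * (u i w - u i z) + thin_mass i \<theta> * (u i t - u i f)) / ?n"
    unfolding menu_def mass_def thin_mass_def
    by (subst Bochner_Integration.integral_add)
      (simp_all add: integrable_if_eu integrable_if_const integrable_thin del: of_nat_add)
  finally show ?thesis .
qed

text \<open>A conforming message earns exactly the null offer, which must then be best. A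
  nonconforming one earns a mixture with positive weight on the average, so the average equals the
  maximum and all offers tie.\<close>

lemma null_is_best:
  assumes m: "m \<in> set_pmf Q" and \<theta>: "\<theta> \<in> Th"
  shows "menu i \<theta> (x, x, x, x) = best i \<theta>"
    and "\<not> (st (m i) = \<theta> \<and> lev (m i) = 0) \<Longrightarrow> menu i \<theta> l = best i \<theta>"
proof -
  have dev: "menu i \<theta> l = best i \<theta>" if n: "\<not> (st (m i) = \<theta> \<and> lev (m i) = 0)" for l
  proof (rule avg_eq_best)
    let ?k = "real (lev (m i))"
    have "?k * menu i \<theta> (rule (m i) \<theta>) + avg i \<theta> = (?k + 1) * best i \<theta>"
      using part_best[OF m \<theta>, of i] unfolding part_deviation[OF n] by (simp add: field_simps)
    moreover have "?k * menu i \<theta> (rule (m i) \<theta>) \<le> ?k * best i \<theta>"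
      by (intro mult_left_mono menu_le_best) simp
    ultimately show "avg i \<theta> = best i \<theta>"
      using avg_le_best[of i \<theta>] by (simp add: algebra_simps)
  qed
  then show "\<not> (st (m i) = \<theta> \<and> lev (m i) = 0) \<Longrightarrow> menu i \<theta> l = best i \<theta>" .
  show "menu i \<theta> (x, x, x, x) = best i \<theta>"
    using dev part_best[OF m \<theta>, of i] part_truth[OF \<theta>, of "m i" i x] by metis
qed

lemma valid_le:
  assumes m: "m \<in> set_pmf Q" and ag: "agree i \<theta> m" and v: "valid i \<theta> (z, w, f, t)"
  shows "mass i \<theta> * (u i w - u i z) + thin_mass i \<theta> * (u i t - u i f) \<le> 0"
proof -
  have \<theta>: "\<theta> \<in> Th" by (rule agree_Th[OF m ag])
  note [simp] = F_ne[OF \<theta>]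
  then show ?thesis
    using menu_valid[OF \<theta> v, of undefined] menu_le_best[of i \<theta> "(z, w, f, t)"]
      null_is_best(1)[OF m \<theta>, of i undefined] by (simp add: divide_le_0_iff)
qed

lemma valid_eq:
  assumes m: "m \<in> set_pmf Q" and ag: "agree i \<theta> m" and v: "valid i \<theta> (z, w, f, t)"
    and dev: "\<not> (st (m i) = \<theta> \<and> lev (m i) = 0)"
  shows "mass i \<theta> * (u i w - u i z) + thin_mass i \<theta> * (u i t - u i f) = 0"
proof -
  have \<theta>: "\<theta> \<in> Th" by (rule agree_Th[OF m ag])
  note [simp] = F_ne[OF \<theta>]
  then show ?thesis
    using menu_valid[OF \<theta> v, of undefined] null_is_best[OF m \<theta>, of i] dev by simp
qed

text \<open>No valid offer may beat conformity. Single moves show that weak losses at \<theta>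
  remain weak losses at \<open>\<theta>0\<close>. If a strict loss has become an indifference, it
  pays for any second move for free, so no second move may be profitable and
  \<open>F \<theta>\<close> is on top of \<open>E i \<theta>\<close>.\<close>

lemma agree_monotone:
  assumes m: "m \<in> set_pmf Q" and ag: "agree i \<theta> m"
  shows "(\<forall>z\<in>F \<theta>. \<forall>w\<in>E i \<theta>. R \<theta>0 i z w) \<or>
    (\<forall>z\<in>F \<theta>. \<forall>w\<in>E i \<theta>. R \<theta> i z w \<longrightarrow> R \<theta>0 i z w \<and> (\<not> R \<theta> i w z \<longrightarrow> \<not> R \<theta>0 i w z))"
proof (rule disjCI)
  assume "\<not> (\<forall>z\<in>F \<theta>. \<forall>w\<in>E i \<theta>. R \<theta> i z w \<longrightarrow> R \<theta>0 i z w \<and> (\<not> R \<theta> i w z \<longrightarrow> \<not> R \<theta>0 i w z))"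
  then obtain z w where zw: "z \<in> F \<theta>" "w \<in> E i \<theta>" "R \<theta> i z w"
    and n: "\<not> R \<theta>0 i z w \<or> (\<not> R \<theta> i w z \<and> R \<theta>0 i w z)" by blast
  have \<theta>: "\<theta> \<in> Th" by (rule agree_Th[OF m ag])
  note pos = mass_pos[OF m ag]
  have "valid i \<theta> (z, w, z, z)" using zw F_E[OF \<theta>, of i] by (auto simp: valid_def)
  from valid_le[OF m ag this] have "u i w \<le> u i z" using pos(1) by (simp add: mult_le_0_iff)
  then have strict: "\<not> R \<theta> i w z" "u i w = u i z" using n u by auto
  show "\<forall>z\<in>F \<theta>. \<forall>w\<in>E i \<theta>. R \<theta>0 i z w"
  proof (intro ballI)
    fix f t assume ft: "f \<in> F \<theta>" "t \<in> E i \<theta>"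
    then have "valid i \<theta> (z, w, f, t)" using zw strict by (simp add: valid_def)
    from valid_le[OF m ag this] have "thin_mass i \<theta> * (u i t - u i f) \<le> 0" using strict(2) by simp
    then show "R \<theta>0 i f t" using pos(2) u by (simp add: mult_le_0_iff)
  qed
qed

lemma deviator_indifferent:
  assumes m: "m \<in> set_pmf Q" and ag: "agree i \<theta> m"
    and dev: "\<not> (st (m i) = \<theta> \<and> lev (m i) = 0)"
  shows "\<forall>x\<in>E i \<theta>. \<forall>y\<in>E i \<theta>. R \<theta>0 i x y"
proof -
  have \<theta>: "\<theta> \<in> Th" by (rule agree_Th[OF m ag])
  note pos = mass_pos[OF m ag]
  have eq: "u i w = u i z" if "z \<in> F \<theta>" "w \<in> E i \<theta>" "R \<theta> i z w" for z w
  proof -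
    have "valid i \<theta> (z, w, z, z)" using that F_E[OF \<theta>, of i] by (auto simp: valid_def)
    from valid_eq[OF m ag this dev] show ?thesis using pos(1) by simp
  qed
  have "\<exists>c. \<forall>x\<in>E i \<theta>. u i x = c"
  proof (cases "\<forall>x\<in>E i \<theta>. \<forall>y\<in>E i \<theta>. R \<theta> i x y")
    case True
    obtain z where "z \<in> F \<theta>" using F_ne[OF \<theta>] by blast
    then have "u i x = u i z" if "x \<in> E i \<theta>" for x
      using True eq[of z x] F_E[OF \<theta>, of i] that by blast
    then show ?thesis by blast
  next
    case False
    then obtain z w where zw: "z \<in> F \<theta>" "w \<in> E i \<theta>" "R \<theta> i z w" "\<not> R \<theta> i w z"
      using E_spread[OF \<theta>, of i] by blast
    have "u i t = u i z" if "t \<in> E i \<theta>" for t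
    proof -
      \<comment> \<open>The first move is already known to be neutral, so the tie between offers
        forces the second one to be neutral too.\<close>
      have "valid i \<theta> (z, w, z, t)" using zw that by (simp add: valid_def)
      from valid_eq[OF m ag this dev] have "thin_mass i \<theta> * (u i t - u i z) = 0"
        using eq[OF zw(1-3)] by simp
      then show ?thesis using pos(2) by simp
    qed
    then show ?thesis by blast
  qed
  then obtain c where "\<And>x. x \<in> E i \<theta> \<Longrightarrow> u i x = c" by blast
  then show ?thesis by (simp add: u)
qed

text \<open>The three branches of \<open>G\<close> correspond to the three conditions: unanimity to
  \<open>monotone\<close>, a single deviator to \<open>no_veto\<close>, the integer game to
  \<open>indifferent\<close>.\<close>

lemma equilibrium_outcomes:
  assumes m: "m \<in> set_pmf Q"
  shows "set_pmf (G m) \<subseteq> F \<theta>0"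
proof (cases "\<exists>i \<theta>. agree i \<theta> m")
  case True
  then obtain j \<theta> where ag: "agree j \<theta> m" by blast
  have \<theta>: "\<theta> \<in> Th" by (rule agree_Th[OF m ag])
  show ?thesis
  proof (cases "st (m j) = \<theta> \<and> lev (m j) = 0")
    case True
    then have un: "unan \<theta> m" using ag unan_agree by blast
    then have "agree i \<theta> m" for i using unan_agree by blast
    then have "F \<theta> \<subseteq> F \<theta>0" using agree_monotone[OF m] by (intro monotone[OF \<theta> \<theta>0]) blast
    then show ?thesis using F_ne[OF \<theta>] by (simp add: G_unan[OF un])
  next
    case False
    let ?K = "others_prec j m"
    have noise: "set_pmf (noise j \<theta> ?K) = E j \<theta>" by (rule set_noise[OF \<theta> total[OF \<theta>]])
    have up: "E j \<theta> \<subseteq> set_pmf (G m)"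
      unfolding G_agree[OF ag False] noise[symmetric] by (rule set_ladder_noise)
    have down: "set_pmf (G m) \<subseteq> E j \<theta>"
      unfolding G_agree[OF ag False] using set_ladder_subset noise set_sel[OF \<theta>] by fast
    \<comment> \<open>Consensus seen by a second agent would mean unanimity. So every other agent is
      at its peak on the whole support, which the noise extends to all of
      \<open>E j \<theta>\<close>.\<close>
    have "out i m" if "i \<noteq> j" for i
      unfolding out_def
    proof (intro allI notI)
      fix \<theta>' assume "agree i \<theta>' m"
      then have "unan \<theta> m" using agree_deviator_unique[OF ag] that by blast
      then show False using False by (simp add: unan_def)
    qed
    then have "R \<theta>0 i x y" if "i \<noteq> j" "x \<in> E j \<theta>" "y \<in> Zs" for i x y
      using out_peak[OF m, of i x] that up peak_ge[of y i] by (auto simp: u)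
    then have "E j \<theta> \<subseteq> F \<theta>0"
      by (intro no_veto[OF \<theta> \<theta>0 _ deviator_indifferent[OF m ag False]]) blast
    then show ?thesis using down by blast
  qed
next
  case False
  then obtain i where "G m = ladder (lev (m i)) (return_pmf (fav (m i))) (pmf_of_set Zs)"
    by (metis G_disagree)
  then have "Zs \<subseteq> set_pmf (G m)" using set_ladder_noise[of "pmf_of_set Zs"] Zs_ne by simp
  moreover have "out i m" for i using False by (simp add: out_def)
  ultimately have "u i x = peak i" if "x \<in> Zs" for i x using out_peak[OF m, of i x] that by blast
  then have "\<forall>i. \<forall>x\<in>Zs. \<forall>y\<in>Zs. R \<theta>0 i x y" by (simp add: u)
  then have "Zs \<subseteq> F \<theta>0" by (rule indifferent[OF \<theta>0])
  then show ?thesis using set_G[of m] Q_Msgs[OF m] by blast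
qed

end

section \<open>Transfer to message spaces of natural numbers\<close>

context canonical
begin

lemma implementable:
  assumes total: "\<And>\<theta> i x y. \<theta> \<in> Th \<Longrightarrow> R \<theta> i x y \<or> R \<theta> i y x"
  shows "mixed_Nash_A_implementable Th R F UNIV"
proof -
  \<comment> \<open>Every natural number decodes to a legal message and every message has a code, so
    all message spaces can be \<open>UNIV\<close>.\<close>
  define dec where "dec = from_nat_into Msgs"
  obtain \<theta>1 where "\<theta>1 \<in> Th" using Th by blast
  moreover obtain b where "b \<in> Zs" using Zs_ne by blast
  ultimately have "Msgs \<noteq> {}" using Msg_in_Msgs by blast
  then have dec: "dec n \<in> Msgs" for n unfolding dec_def by (rule from_nat_into)
  have enc: "\<exists>n. dec n = a" if "a \<in> Msgs" for a
    using from_nat_into_surj[OF countable_Msgs that] by (simp add: dec_def)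
  define g where "g x = G (\<lambda>i. dec (x i))" for x
  have upd: "(\<lambda>j. dec ((x(i := n)) j)) = (\<lambda>j. dec (x j))(i := dec n)" for x :: "'i \<Rightarrow> nat" and i n
    by auto
  have "(\<Union>lam\<in>MNE (\<lambda>_. UNIV) g u. set_pmf (outcome g lam)) = F \<theta>"
    if \<theta>: "\<theta> \<in> Th" and u: "u \<in> Omega (R \<theta>) UNIV" for \<theta> u
  proof
    show "F \<theta> \<subseteq> (\<Union>lam\<in>MNE (\<lambda>_. UNIV) g u. set_pmf (outcome g lam))"
    proof -
      obtain a where a: "a \<in> Msgs" "G (\<lambda>_. a) = pmf_of_set (F \<theta>)"
        "\<And>i b. eu u i (G ((\<lambda>_. a)(i := b))) \<le> eu u i (G (\<lambda>_. a))"
        by (rule truthful_equilibrium[OF \<theta> u]) blast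
      obtain n where n: "dec n = a" using enc a by blast
      have "(\<lambda>i. return_pmf ((\<lambda>_. n) i)) \<in> MNE (\<lambda>_. UNIV) g u"
        using a(3) by (intro MNE_pureI) (simp_all only: g_def upd n, simp_all)
      moreover have "outcome g (\<lambda>i. return_pmf ((\<lambda>_. n) i)) = pmf_of_set (F \<theta>)"
        by (subst outcome_pure_profile) (simp add: g_def n a)
      ultimately have "set_pmf (pmf_of_set (F \<theta>)) \<subseteq> (\<Union>lam\<in>MNE (\<lambda>_. UNIV) g u. set_pmf (outcome g lam))"
        by (metis UN_upper)
      then show ?thesis using F_ne[OF \<theta>] by simp
    qed
    show "(\<Union>lam\<in>MNE (\<lambda>_. UNIV) g u. set_pmf (outcome g lam)) \<subseteq> F \<theta>"
    proof (rule UN_least)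
      fix lam assume lam: "lam \<in> MNE (\<lambda>_. UNIV) g u"
      define P where "P = Pi_pmf UNIV undefined lam"
      define Q where "Q = map_pmf (\<lambda>x i. dec (x i)) P"
      have payoff: "measure_pmf.expectation Q (\<lambda>m. eu u i (G (m(i := dec n)))) =
          eu u i (outcome g (lam(i := return_pmf n)))" for i n
        unfolding eu_outcome_return g_def upd by (simp add: Q_def P_def)
      have supp: "x i \<in> set_pmf (lam i)" if "x \<in> set_pmf P" for x i
        using that by (simp add: P_def set_Pi_pmf PiE_dflt_def)
      interpret canonical_equilibrium Th R F Zs E Q u "\<lambda>i. eu u i (outcome g lam)" \<theta>
      proof
        show "measure_pmf.expectation Q (\<lambda>m. eu u i (G (m(i := a)))) \<le> eu u i (outcome g lam)"
          if "a \<in> Msgs" for i a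
        proof -
          from enc[OF \<open>a \<in> Msgs\<close>] obtain n where "dec n = a" ..
          then show ?thesis using payoff[of i n] MNE_pure_deviation[OF lam, of n i] by simp
        qed
        show "measure_pmf.expectation Q (\<lambda>m'. eu u i (G (m'(i := m i)))) = eu u i (outcome g lam)"
          if "m \<in> set_pmf Q" for i m
        proof -
          obtain x where x: "x \<in> set_pmf P" "m = (\<lambda>i. dec (x i))" using \<open>m \<in> set_pmf Q\<close> by (auto simp: Q_def)
          show ?thesis unfolding x(2) payoff by (rule MNE_support[OF lam supp[OF x(1)]])
        qed
      qed (use total \<theta> u in \<open>auto simp: Omega_def Q_def dec\<close>)
      show "set_pmf (outcome g lam) \<subseteq> F \<theta>"
        using equilibrium_outcomes by (force simp: outcome_def Q_def P_def g_def)
    qed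
  qed
  then show ?thesis
    unfolding mixed_Nash_A_implementable_def
    by (intro exI[of _ "\<lambda>_. UNIV"] exI[of _ g]) (simp add: mechanism_def)
qed

end

section \<open>Rational implementability\<close>

text \<open>If \<open>F\<close> is on top of \<open>E\<close>, its elements are equivalent and any
  rational representation will do. Otherwise the representation that keeps the values on
  \<open>F\<close> and does not raise those on \<open>E\<close> preserves each comparison in favour
  of \<open>F\<close>.\<close>

lemma rational_monotone:
  fixes v v' :: "'z::finite \<Rightarrow> real" and r r' :: "'z \<Rightarrow> 'z \<Rightarrow> bool"
  assumes r': "complete_preorder r'" and ne: "F \<noteq> {}"
    and v: "\<And>x y. r x y \<longleftrightarrow> v x \<ge> v y" "\<And>x. v x \<in> \<rat>"
    and v': "\<And>x y. r' x y \<longleftrightarrow> v' x \<ge> v' y" "\<And>x. v' x \<in> \<rat>"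
    and FE: "F \<subseteq> E"
    and dom: "(\<forall>z\<in>F. \<forall>w\<in>E. r' z w) \<or>
      (\<forall>z\<in>F. \<forall>w\<in>E. r z w \<longrightarrow> r' z w \<and> (\<not> r w z \<longrightarrow> \<not> r' w z))"
  shows "\<exists>w :: 'z \<Rightarrow> real. (\<forall>x y. r' x y \<longleftrightarrow> w x \<ge> w y) \<and> (\<forall>x. w x \<in> \<rat>) \<and>
    (\<forall>x y. set_pmf x \<subseteq> F \<longrightarrow> set_pmf y \<subseteq> E \<longrightarrow> eu (\<lambda>_. v) i y \<le> eu (\<lambda>_. v) i x \<longrightarrow>
      eu (\<lambda>_. w) i y \<le> eu (\<lambda>_. w) i x)"
  using dom
proof
  assume top: "\<forall>z\<in>F. \<forall>w\<in>E. r' z w"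
  obtain f where f: "f \<in> F" using ne by blast
  have "eu (\<lambda>_. v') i y \<le> eu (\<lambda>_. v') i x" if xy: "set_pmf x \<subseteq> F" "set_pmf y \<subseteq> E" for x y
  proof -
    have "v' z = v' f" if "z \<in> F" for z
      using top that f FE v'(1)[of z f] v'(1)[of f z] by (meson antisym subsetD)
    then have "eu (\<lambda>_. v') i x = v' f" using xy by (intro eu_const) blast
    moreover have "eu (\<lambda>_. v') i y \<le> v' f" using xy top f v'(1) by (intro eu_le) blast
    ultimately show ?thesis by simp
  qed
  then show ?thesis using v' by blast
next
  assume *: "\<forall>z\<in>F. \<forall>w\<in>E. r z w \<longrightarrow> r' z w \<and> (\<not> r w z \<longrightarrow> \<not> r' w z)"
  obtain w where w: "\<And>x y. r' x y \<longleftrightarrow> w x \<ge> w y" "\<And>x. w x \<in> \<rat>"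
    "\<And>z. z \<in> F \<Longrightarrow> w z = v z" "\<And>z. z \<in> E \<Longrightarrow> w z \<le> v z"
    by (rule rational_representation_below[of r' r v F E, OF r' v FE]) (use * in blast)+
  have "eu (\<lambda>_. w) i y \<le> eu (\<lambda>_. w) i x"
    if xy: "set_pmf x \<subseteq> F" "set_pmf y \<subseteq> E" "eu (\<lambda>_. v) i y \<le> eu (\<lambda>_. v) i x" for x y
  proof -
    have "eu (\<lambda>_. w) i y \<le> eu (\<lambda>_. v) i y" using w(4) xy(2) by (intro eu_le_eu) blast
    also have "\<dots> \<le> eu (\<lambda>_. v) i x" by (rule xy(3))
    also have "\<dots> \<le> eu (\<lambda>_. w) i x" using w(3) xy(1) by (intro eu_le_eu) (metis order_refl subsetD)
    finally show ?thesis .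
  qed
  then show ?thesis using w(1,2) by (intro exI[of _ w]) blast
qed

lemma eu_component: "eu u i y = eu (\<lambda>_. u i) i y"
  by (simp add: eu_def)

text \<open>\<open>E_spread\<close> follows from the equilibrium inequality. The last three
  conditions follow by exhibiting profiles that are equilibria at some rational utility of the state
  concerned, whose outcomes must then lie in \<open>F\<close>.\<close>

lemma canonical_from_rational:
  fixes Th :: "'th set"
    and R :: "'th \<Rightarrow> 'i::finite \<Rightarrow> 'z::finite \<Rightarrow> 'z \<Rightarrow> bool"
    and F :: "'th \<Rightarrow> 'z set"
  assumes card: "CARD('i) \<ge> 3" and fin: "finite Th" and ne: "Th \<noteq> {}"
    and pre: "\<And>\<theta> i. \<theta> \<in> Th \<Longrightarrow> complete_preorder (R \<theta> i)"
    and F_ne: "\<And>\<theta>. \<theta> \<in> Th \<Longrightarrow> F \<theta> \<noteq> {}"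
    and impl: "mixed_Nash_A_implementable Th R F \<rat>"
  shows "\<exists>Zs E. canonical Th R F Zs E"
proof -
  obtain M g where
    Mg: "\<And>\<theta> u. \<theta> \<in> Th \<Longrightarrow> u \<in> Omega (R \<theta>) \<rat> \<Longrightarrow> (\<Union>lam\<in>MNE M g u. set_pmf (outcome g lam)) = F \<theta>"
    using impl unfolding mixed_Nash_A_implementable_def by blast
  have "\<exists>v. v \<in> Omega (R \<theta>) \<rat>" if "\<theta> \<in> Th" for \<theta>
    using Omega_rat_nonempty[of "R \<theta>"] pre[OF that] by blast
  then have "\<forall>\<theta>\<in>Th. \<exists>v. v \<in> Omega (R \<theta>) \<rat>" by blast
  from bchoice[OF this] obtain v where v: "\<And>\<theta>. \<theta> \<in> Th \<Longrightarrow> v \<theta> \<in> Omega (R \<theta>) \<rat>" by blast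
  have R: "R \<theta> i x y \<longleftrightarrow> v \<theta> i x \<ge> v \<theta> i y" and Q: "v \<theta> i x \<in> \<rat>" if "\<theta> \<in> Th" for \<theta> i x y
    using v[OF that] by (auto simp: Omega_def)
  define Zs where "Zs = (\<Union>lam\<in>Collect (mixed_profile M). set_pmf (outcome g lam))"
  define E where "E j \<theta> = (\<Union>lam\<in>MNE M g (v \<theta>). \<Union>mu\<in>{mu. set_pmf mu \<subseteq> M j}.
    set_pmf (outcome g (lam(j := mu))))" for j \<theta>
  have Zs_I: "set_pmf (outcome g lam) \<subseteq> Zs" if "mixed_profile M lam" for lam
    using that unfolding Zs_def by blast
  have mixed: "mixed_profile M lam" if "lam \<in> MNE M g u" for lam u
    using that by (simp add: MNE_def)
  have mixed_upd: "mixed_profile M (lam(j := mu))" if "mixed_profile M lam" "set_pmf mu \<subseteq> M j" for lam j mu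
    using that by (simp add: mixed_profile_def)
  have E_I: "set_pmf (outcome g (lam(j := mu))) \<subseteq> E j \<theta>"
    if "lam \<in> MNE M g (v \<theta>)" "set_pmf mu \<subseteq> M j" for lam j mu \<theta>
    using that unfolding E_def by blast
  have E_I': "set_pmf (outcome g lam) \<subseteq> E j \<theta>" if "lam \<in> MNE M g (v \<theta>)" for lam j \<theta>
    using E_I[OF that, of "lam j" j] mixed[OF that] by (simp add: mixed_profile_def)
  have F_I: "set_pmf (outcome g lam) \<subseteq> F \<theta>"
    if "\<theta> \<in> Th" "u \<in> Omega (R \<theta>) \<rat>" "lam \<in> MNE M g u" for lam \<theta> u
    using Mg[OF that(1,2)] that(3) by blast
  have F_E: "F \<theta> \<subseteq> E i \<theta>" if \<theta>: "\<theta> \<in> Th" for \<theta> i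
  proof
    fix z assume "z \<in> F \<theta>"
    then obtain lam where "lam \<in> MNE M g (v \<theta>)" "z \<in> set_pmf (outcome g lam)"
      using Mg[OF \<theta> v[OF \<theta>]] by blast
    then show "z \<in> E i \<theta>" using E_I'[of lam \<theta> i] by blast
  qed
  have E_Zs: "E i \<theta> \<subseteq> Zs" for i \<theta>
    unfolding E_def by (intro UN_least Zs_I mixed_upd mixed) simp_all
  have "canonical Th R F Zs E"
  proof
    show "CARD('i) \<ge> 3" "finite Th" "Th \<noteq> {}" by fact+
    show "F \<theta> \<noteq> {}" "F \<theta> \<subseteq> E i \<theta>" "E i \<theta> \<subseteq> Zs" if "\<theta> \<in> Th" for \<theta> i
      by (rule F_ne[OF that] F_E[OF that] E_Zs)+
  next
    fix \<theta> i assume \<theta>: "\<theta> \<in> Th"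
    show "(\<forall>x\<in>E i \<theta>. \<forall>y\<in>E i \<theta>. R \<theta> i x y) \<or> (\<exists>z\<in>F \<theta>. \<exists>w\<in>E i \<theta>. R \<theta> i z w \<and> \<not> R \<theta> i w z)"
    proof (rule disjCI)
      assume none: "\<not> (\<exists>z\<in>F \<theta>. \<exists>w\<in>E i \<theta>. R \<theta> i z w \<and> \<not> R \<theta> i w z)"
      have low: "v \<theta> i z \<le> v \<theta> i w" if "z \<in> F \<theta>" "w \<in> E i \<theta>" for z w
      proof -
        have "\<not> (R \<theta> i z w \<and> \<not> R \<theta> i w z)" using none that by blast
        then show ?thesis unfolding R[OF \<theta>] by linarith
      qed
      obtain f where f: "f \<in> F \<theta>" using F_ne[OF \<theta>] by blast
      \<comment> \<open>The deviation cannot yield more than the equilibrium, hence no more than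
        \<open>v \<theta> i f\<close>, while each of its outcomes is at least that good; so none is
        better.\<close>
      have "v \<theta> i e = v \<theta> i f" if e: "e \<in> E i \<theta>" for e
      proof -
        obtain lam mu where lam: "lam \<in> MNE M g (v \<theta>)" "set_pmf mu \<subseteq> M i"
          and e': "e \<in> set_pmf (outcome g (lam(i := mu)))"
          using e unfolding E_def by blast
        have "eu (v \<theta>) i (outcome g (lam(i := mu))) \<le> eu (v \<theta>) i (outcome g lam)"
          using lam by (simp add: MNE_def)
        also have "\<dots> \<le> v \<theta> i f"
          using F_I[OF \<theta> v[OF \<theta>] lam(1)] low f F_E[OF \<theta>, of i] by (intro eu_le) blast
        finally have "eu (v \<theta>) i (outcome g (lam(i := mu))) \<le> v \<theta> i f" .
        moreover have "v \<theta> i f \<le> v \<theta> i z" if "z \<in> set_pmf (outcome g (lam(i := mu)))" for z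
          using low[OF f] E_I[OF lam] that by blast
        ultimately show ?thesis using e' by (intro eu_attains_lower_bound[of "outcome g (lam(i := mu))"])
      qed
      then show "\<forall>x\<in>E i \<theta>. \<forall>y\<in>E i \<theta>. R \<theta> i x y" by (simp add: R[OF \<theta>])
    qed
  next
    fix \<theta> assume \<theta>: "\<theta> \<in> Th" and ind: "\<forall>i. \<forall>x\<in>Zs. \<forall>y\<in>Zs. R \<theta> i x y"
    show "Zs \<subseteq> F \<theta>"
    proof
      fix z assume z: "z \<in> Zs"
      then obtain lam where lam: "mixed_profile M lam" "z \<in> set_pmf (outcome g lam)"
        by (auto simp: Zs_def)
      have const: "eu (v \<theta>) i (outcome g lam') = v \<theta> i z" if "mixed_profile M lam'" for i lam'
      proof (rule eu_const)
        fix x assume "x \<in> set_pmf (outcome g lam')"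
        then have "x \<in> Zs" using Zs_I[OF that] by blast
        then have "R \<theta> i x z" "R \<theta> i z x" using ind z by simp_all
        then show "v \<theta> i x = v \<theta> i z" by (simp add: R[OF \<theta>])
      qed
      \<comment> \<open>With all reachable outcomes equivalent for everybody, any mixed profile is
        an equilibrium.\<close>
      have "lam \<in> MNE M g (v \<theta>)" using lam(1) mixed_upd const by (simp add: MNE_def)
      then show "z \<in> F \<theta>" using F_I[OF \<theta> v[OF \<theta>]] lam(2) by blast
    qed
  next
    fix \<theta> \<theta>' j assume \<theta>: "\<theta> \<in> Th" and \<theta>': "\<theta>' \<in> Th"
      and others: "\<forall>i. i \<noteq> j \<longrightarrow> (\<forall>x\<in>E j \<theta>. \<forall>y\<in>Zs. R \<theta>' i x y)"
      and own: "\<forall>x\<in>E j \<theta>. \<forall>y\<in>E j \<theta>. R \<theta>' j x y"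
    show "E j \<theta> \<subseteq> F \<theta>'"
    proof
      fix e assume e: "e \<in> E j \<theta>"
      then obtain lam mu where lam: "lam \<in> MNE M g (v \<theta>)" "set_pmf mu \<subseteq> M j"
        and e': "e \<in> set_pmf (outcome g (lam(j := mu)))"
        unfolding E_def by blast
      \<comment> \<open>The profile after the deviation is an equilibrium at \<theta>':
        \<open>j\<close> can only move within \<open>E j \<theta>\<close> and is indifferent there,
        and the others already have their favourite reachable outcomes.\<close>
      have "eu (v \<theta>') i (outcome g (lam(j := mu, i := mu'))) \<le> eu (v \<theta>') i (outcome g (lam(j := mu)))"
        if mu': "set_pmf mu' \<subseteq> M i" for i mu'
      proof (cases "i = j")
        case True
        have "eu (v \<theta>') j (outcome g (lam(j := nu))) = v \<theta>' j e" if "set_pmf nu \<subseteq> M j" for nu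
        proof (rule eu_const)
          fix x assume "x \<in> set_pmf (outcome g (lam(j := nu)))"
          then have "x \<in> E j \<theta>" using E_I[OF lam(1) that] by blast
          then have "R \<theta>' j x e" "R \<theta>' j e x" using own e by simp_all
          then show "v \<theta>' j x = v \<theta>' j e" by (simp add: R[OF \<theta>'])
        qed
        then show ?thesis using True mu' lam(2) by simp
      next
        case False
        have peak: "v \<theta>' i x \<ge> v \<theta>' i y" if "x \<in> E j \<theta>" "y \<in> Zs" for x y
          using others False that by (simp flip: R[OF \<theta>'])
        have "eu (v \<theta>') i (outcome g (lam(j := mu))) = v \<theta>' i e"
        proof (rule eu_const)
          fix x assume "x \<in> set_pmf (outcome g (lam(j := mu)))"
          then have "x \<in> E j \<theta>" using E_I[OF lam] by blast
          then show "v \<theta>' i x = v \<theta>' i e" using e E_Zs[of j \<theta>] by (intro antisym peak) auto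
        qed
        moreover have "eu (v \<theta>') i (outcome g (lam(j := mu, i := mu'))) \<le> v \<theta>' i e"
        proof (rule eu_le)
          fix x assume "x \<in> set_pmf (outcome g (lam(j := mu, i := mu')))"
          then have "x \<in> Zs"
            using Zs_I[OF mixed_upd[OF mixed_upd[OF mixed[OF lam(1)] lam(2)] mu']] by blast
          then show "v \<theta>' i x \<le> v \<theta>' i e" by (rule peak[OF e])
        qed
        ultimately show ?thesis by simp
      qed
      then have "lam(j := mu) \<in> MNE M g (v \<theta>')"
        using mixed_upd[OF mixed[OF lam(1)] lam(2)] unfolding MNE_def by blast
      then show "e \<in> F \<theta>'" using F_I[OF \<theta>' v[OF \<theta>']] e' by blast
    qed
  next
    fix \<theta> \<theta>' assume \<theta>: "\<theta> \<in> Th" and \<theta>': "\<theta>' \<in> Th"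
      and dom: "\<forall>i. (\<forall>z\<in>F \<theta>. \<forall>w\<in>E i \<theta>. R \<theta>' i z w) \<or>
        (\<forall>z\<in>F \<theta>. \<forall>w\<in>E i \<theta>. R \<theta> i z w \<longrightarrow> R \<theta>' i z w \<and> (\<not> R \<theta> i w z \<longrightarrow> \<not> R \<theta>' i w z))"
    define P where "P i w \<longleftrightarrow> (\<forall>x y. R \<theta>' i x y \<longleftrightarrow> w x \<ge> w y) \<and> (\<forall>x. w x \<in> \<rat>) \<and>
      (\<forall>x y. set_pmf x \<subseteq> F \<theta> \<longrightarrow> set_pmf y \<subseteq> E i \<theta> \<longrightarrow>
        eu (\<lambda>_. v \<theta> i) i y \<le> eu (\<lambda>_. v \<theta> i) i x \<longrightarrow> eu (\<lambda>_. w) i y \<le> eu (\<lambda>_. w) i x)"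
      for i and w :: "'z \<Rightarrow> real"
    have "\<exists>w. P i w" for i
      unfolding P_def
      by (rule rational_monotone[of "R \<theta>' i" "F \<theta>" "R \<theta> i" "v \<theta> i" "v \<theta>' i" "E i \<theta>" i,
        OF pre[OF \<theta>'] F_ne[OF \<theta>] R[OF \<theta>] Q[OF \<theta>] R[OF \<theta>'] Q[OF \<theta>'] F_E[OF \<theta>] dom[THEN spec]])
    \<comment> \<open>Equilibrium is a condition on each agent separately, so utilities chosen agent
      by agent combine into one rational profile for \<theta>'.\<close>
    then obtain w where P: "\<And>i. P i (w i)" by metis
    have w: "R \<theta>' i x y \<longleftrightarrow> w i x \<ge> w i y" "w i x \<in> \<rat>" for i x y
      using P[of i] unfolding P_def by simp_all
    have w_dom: "eu (\<lambda>_. w i) i y \<le> eu (\<lambda>_. w i) i x"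
      if "set_pmf x \<subseteq> F \<theta>" "set_pmf y \<subseteq> E i \<theta>" "eu (\<lambda>_. v \<theta> i) i y \<le> eu (\<lambda>_. v \<theta> i) i x" for i x y
      using P[of i] that unfolding P_def by simp
    have w_Om: "w \<in> Omega (R \<theta>') \<rat>" using w by (simp add: Omega_def)
    \<comment> \<open>Equilibrium lotteries live on \<open>F \<theta>\<close> and deviations on
      \<open>E i \<theta>\<close>, which is where \<open>w_dom\<close> applies.\<close>
    have "lam \<in> MNE M g w" if lam: "lam \<in> MNE M g (v \<theta>)" for lam
    proof -
      have "eu w i (outcome g (lam(i := mu))) \<le> eu w i (outcome g lam)" if mu: "set_pmf mu \<subseteq> M i" for i mu
      proof -
        have "eu (v \<theta>) i (outcome g (lam(i := mu))) \<le> eu (v \<theta>) i (outcome g lam)"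
          using lam mu by (simp add: MNE_def)
        then show ?thesis
          using w_dom[OF F_I[OF \<theta> v[OF \<theta>] lam] E_I[OF lam mu]]
          by (simp only: eu_component[of w] eu_component[of "v \<theta>"])
      qed
      then show ?thesis using mixed[OF lam] by (simp add: MNE_def)
    qed
    then show "F \<theta> \<subseteq> F \<theta>'"
      using Mg[OF \<theta> v[OF \<theta>]] Mg[OF \<theta>' w_Om] by blast
  qed
  then show ?thesis by blast
qed

theorem theorem7:
  fixes Th :: "'th set"
    and R :: "'th \<Rightarrow> 'i::finite \<Rightarrow> 'z::finite \<Rightarrow> 'z \<Rightarrow> bool"
    and F :: "'th \<Rightarrow> 'z set"
  assumes "CARD('i) \<ge> 3"
    and "finite Th"
    and "\<forall>\<theta>\<in>Th. \<forall>i. complete_preorder (R \<theta> i)"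
    and "\<forall>\<theta>\<in>Th. F \<theta> \<noteq> {}"
  shows "mixed_Nash_A_implementable Th R F \<rat> \<longleftrightarrow> mixed_Nash_A_implementable Th R F UNIV"
proof
  assume "mixed_Nash_A_implementable Th R F UNIV"
  then obtain M and g :: "('i \<Rightarrow> nat) \<Rightarrow> 'z pmf" where M: "mechanism M"
    and g: "\<forall>\<theta>\<in>Th. \<forall>u\<in>Omega (R \<theta>) UNIV. (\<Union>lam\<in>MNE M g u. set_pmf (outcome g lam)) = F \<theta>"
    unfolding mixed_Nash_A_implementable_def by auto
  \<comment> \<open>Rational profiles are among the real ones, so the same mechanism serves.\<close>
  have "Omega (R \<theta>) \<rat> \<subseteq> Omega (R \<theta>) UNIV" for \<theta> by (auto simp: Omega_def)
  then have "\<forall>\<theta>\<in>Th. \<forall>u\<in>Omega (R \<theta>) \<rat>. (\<Union>lam\<in>MNE M g u. set_pmf (outcome g lam)) = F \<theta>"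
    using g by (meson subsetD)
  then show "mixed_Nash_A_implementable Th R F \<rat>"
    unfolding mixed_Nash_A_implementable_def using M by (intro exI conjI)
next
  assume impl: "mixed_Nash_A_implementable Th R F \<rat>"
  show "mixed_Nash_A_implementable Th R F UNIV"
  proof (cases "Th = {}")
    case True
    then show ?thesis
      unfolding mixed_Nash_A_implementable_def mechanism_def by (intro exI[of _ "\<lambda>_. UNIV"]) simp
  next
    case False
    have "\<exists>Zs E. canonical Th R F Zs E"
      by (rule canonical_from_rational[OF assms(1,2) False _ _ impl]) (simp_all add: assms(3,4))
    then obtain Zs E where "canonical Th R F Zs E" by blast
    then show ?thesis
      by (rule canonical.implementable) (use assms(3) in \<open>auto simp: complete_preorder_def\<close>)
  qed
qed

end
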